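(* Let $G$ be a second countable, locally compact étale groupoid with $G^{(0)}$ Hausdorff. Suppose $\pi:\mathscr{C}(G) \to B(\mathscr{H})$ is a $*$-homomorphism for some Hilbert space $\mathscr{H}$. Then $\pi$ is bounded with respect to the $I$-norm on $\mathscr{C}(G)$.
   Context: A topological groupoid $G$ (with unit space $G^{(0)}$, source $s$ and range $r$) is étale if $s$ (hence $r$) is a local homeomorphism. Locally compact means every point has a neighborhood base of compact sets, where compact means every open cover has a finite subcover; $G$ itself need not be Hausdorff. For an open Hausdorff subset $U\subseteq G$, $C_c(U)$ is the set of continuous functions $U\to\mathbb{C}$ that vanish outside some compact subset of $U$, viewed as functions on $G$ by extending them by zero outside $U$. Then $\mathscr{C}(G)=\operatorname{span}_{\mathbb{C}}\{f\in C_c(U): U\subseteq G\text{ open and Hausdorff}\}$, a $*$-algebra under convolution $f*g(\gamma)=\sum_{\alpha\beta=\gamma}f(\alpha)g(\beta)$ and involution $f^*(\gamma)=\overline{f(\gamma^{-1})}$. The $I$-norm is \[ \|f\|_I = \sup_{x \in G^{(0)}} \max\Big\{\sum_{\{\gamma : s(\gamma)=x\}}|f(\gamma)|,\ \sum_{\{\gamma : r(\gamma)=x\}} |f(\gamma)|\Big\}.\] $\pi$ is bounded with respect to the $I$-norm if there is a constant $M\ge 0$ with $\|\pi(f)\|\le M\|f\|_I$ for all $f\in\mathscr{C}(G)$, where $\|\pi(f)\|$ is the operator norm. $*$-homomorphisms are not assumed bounded or continuous. *)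

theory Defs
  imports "HOL-Analysis.Analysis" "HOL-Library.Function_Algebras"
begin

section \<open>Topological groupoids\<close>

text \<open>The set of arrows is \<^term>\<open>topspace (gtop G)\<close>. Multiplication is a total function, but is
  only meaningful on composable pairs.\<close>

record 'g groupoid_data =
  gtop :: "'g topology"
  src :: "'g \<Rightarrow> 'g"
  rng :: "'g \<Rightarrow> 'g"
  gmul :: "'g \<Rightarrow> 'g \<Rightarrow> 'g"
  ginv :: "'g \<Rightarrow> 'g"

abbreviation arrows :: "'g groupoid_data \<Rightarrow> 'g set"
  where "arrows G \<equiv> topspace (gtop G)"

definition unit_space :: "'g groupoid_data \<Rightarrow> 'g set"
  where "unit_space G = src G ` arrows G"

definition unit_topology :: "'g groupoid_data \<Rightarrow> 'g topology"
  where "unit_topology G = subtopology (gtop G) (unit_space G)"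

definition composable :: "'g groupoid_data \<Rightarrow> ('g \<times> 'g) set"
  where "composable G = {(a, b). a \<in> arrows G \<and> b \<in> arrows G \<and> src G a = rng G b}"

text \<open>Units are identified with identity arrows. Source and range need no continuity axiom: they
  are \<open>\<gamma> \<mapsto> \<gamma>\<inverse>\<gamma>\<close> and \<open>\<gamma> \<mapsto> \<gamma>\<gamma>\<inverse>\<close>.\<close>

locale topological_groupoid =
  fixes G :: "'g groupoid_data"
  assumes src_in: "a \<in> arrows G \<Longrightarrow> src G a \<in> arrows G"
    and rng_in: "a \<in> arrows G \<Longrightarrow> rng G a \<in> unit_space G"
    and src_unit: "x \<in> unit_space G \<Longrightarrow> src G x = x"
    and rng_unit: "x \<in> unit_space G \<Longrightarrow> rng G x = x"
    and mul_in: "(a, b) \<in> composable G \<Longrightarrow> gmul G a b \<in> arrows G"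
    and src_mul: "(a, b) \<in> composable G \<Longrightarrow> src G (gmul G a b) = src G b"
    and rng_mul: "(a, b) \<in> composable G \<Longrightarrow> rng G (gmul G a b) = rng G a"
    and mul_assoc: "\<lbrakk>(a, b) \<in> composable G; (b, c) \<in> composable G\<rbrakk> \<Longrightarrow>
      gmul G (gmul G a b) c = gmul G a (gmul G b c)"
    and mul_src: "a \<in> arrows G \<Longrightarrow> gmul G a (src G a) = a"
    and rng_mul_self: "a \<in> arrows G \<Longrightarrow> gmul G (rng G a) a = a"
    and inv_in: "a \<in> arrows G \<Longrightarrow> ginv G a \<in> arrows G"
    and src_inv: "a \<in> arrows G \<Longrightarrow> src G (ginv G a) = rng G a"
    and rng_inv: "a \<in> arrows G \<Longrightarrow> rng G (ginv G a) = src G a"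
    and inv_mul: "a \<in> arrows G \<Longrightarrow> gmul G (ginv G a) a = src G a"
    and mul_inv: "a \<in> arrows G \<Longrightarrow> gmul G a (ginv G a) = rng G a"
    and continuous_mul:
      "continuous_map (subtopology (prod_topology (gtop G) (gtop G)) (composable G)) (gtop G)
        (\<lambda>(a, b). gmul G a b)"
    and continuous_inv: "continuous_map (gtop G) (gtop G) (ginv G)"

definition local_homeomorphism :: "'a topology \<Rightarrow> 'b topology \<Rightarrow> ('a \<Rightarrow> 'b) \<Rightarrow> bool"
  where "local_homeomorphism X Y f \<longleftrightarrow>
    (\<forall>x \<in> topspace X. \<exists>U. openin X U \<and> x \<in> U \<and> openin Y (f ` U) \<and>
      homeomorphic_map (subtopology X U) (subtopology Y (f ` U)) f)"

locale etale_groupoid = topological_groupoid +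
  assumes src_local_homeomorphism: "local_homeomorphism (gtop G) (unit_topology G) (src G)"

text \<open>Without the Hausdorff property this is stronger than \<^const>\<open>locally_compact_space\<close>.\<close>

definition locally_compact :: "'a topology \<Rightarrow> bool"
  where "locally_compact X \<longleftrightarrow> neighbourhood_base_of (compactin X) X"


section \<open>The convolution algebra\<close>

definition C_c :: "'a topology \<Rightarrow> 'a set \<Rightarrow> ('a \<Rightarrow> complex) set"
  where "C_c X U = {f. continuous_map (subtopology X U) euclidean f \<and>
    (\<exists>K. compactin X K \<and> K \<subseteq> U \<and> (\<forall>x. x \<notin> K \<longrightarrow> f x = 0))}"

definition scale_fun :: "complex \<Rightarrow> ('a \<Rightarrow> complex) \<Rightarrow> 'a \<Rightarrow> complex"
  where "scale_fun c f = (\<lambda>x. c * f x)"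

lemma vector_space_scale_fun: "vector_space scale_fun"
  by unfold_locales (auto simp: scale_fun_def fun_eq_iff algebra_simps)

definition conv_algebra :: "'g groupoid_data \<Rightarrow> ('g \<Rightarrow> complex) set"
  where "conv_algebra G = module.span scale_fun
    (\<Union>U \<in> {U. openin (gtop G) U \<and> Hausdorff_space (subtopology (gtop G) U)}. C_c (gtop G) U)"

text \<open>For elements of the convolution algebra of an etale groupoid, only finitely many terms of
  this sum are nonzero.\<close>

definition convolve :: "'g groupoid_data \<Rightarrow> ('g \<Rightarrow> complex) \<Rightarrow> ('g \<Rightarrow> complex) \<Rightarrow> 'g \<Rightarrow> complex"
  where "convolve G f g = (\<lambda>c.
    \<Sum>\<^sub>\<infinity>(a, b) \<in> {(a, b) \<in> composable G. gmul G a b = c}. f a * g b)"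

definition involute :: "'g groupoid_data \<Rightarrow> ('g \<Rightarrow> complex) \<Rightarrow> 'g \<Rightarrow> complex"
  where "involute G f = (\<lambda>c. if c \<in> arrows G then cnj (f (ginv G c)) else 0)"

definition I_norm :: "'g groupoid_data \<Rightarrow> ('g \<Rightarrow> complex) \<Rightarrow> ennreal"
  where "I_norm G f = (SUP x \<in> unit_space G.
    max (\<Sum>\<^sub>\<infinity>c \<in> {c \<in> arrows G. src G c = x}. ennreal (cmod (f c)))
        (\<Sum>\<^sub>\<infinity>c \<in> {c \<in> arrows G. rng G c = x}. ennreal (cmod (f c))))"


section \<open>Operators on complex Hilbert spaces\<close>

text \<open>The inner product is linear in the first argument. The norm comes from \<^class>\<open>banach\<close>.\<close>

class complex_hilbert = banach +
  fixes scaleC :: "complex \<Rightarrow> 'a \<Rightarrow> 'a"  (infixr "*\<^sub>C" 75)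
    and cinner :: "'a \<Rightarrow> 'a \<Rightarrow> complex"
  assumes scaleC_add_right: "c *\<^sub>C (x + y) = c *\<^sub>C x + c *\<^sub>C y"
    and scaleC_add_left: "(c + d) *\<^sub>C x = c *\<^sub>C x + d *\<^sub>C x"
    and scaleC_scaleC: "c *\<^sub>C d *\<^sub>C x = (c * d) *\<^sub>C x"
    and scaleC_of_real: "complex_of_real t *\<^sub>C x = t *\<^sub>R x"
    and cinner_commute: "cinner x y = cnj (cinner y x)"
    and cinner_add_left: "cinner (x + y) z = cinner x z + cinner y z"
    and cinner_scaleC_left: "cinner (c *\<^sub>C x) y = c * cinner x y"
    and cinner_self: "cinner x x = complex_of_real ((norm x)\<^sup>2)"

text \<open>The norm on \<open>\<Rightarrow>\<^sub>L\<close> is the operator norm; its elements are only real linear.\<close>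

definition bounded_operators :: "('h::complex_hilbert \<Rightarrow>\<^sub>L 'h) set"
  where "bounded_operators = {T. \<forall>c x. blinfun_apply T (c *\<^sub>C x) = c *\<^sub>C blinfun_apply T x}"

definition is_adjoint :: "('h::complex_hilbert \<Rightarrow>\<^sub>L 'h) \<Rightarrow> ('h \<Rightarrow>\<^sub>L 'h) \<Rightarrow> bool"
  where "is_adjoint T S \<longleftrightarrow>
    (\<forall>x y. cinner (blinfun_apply T x) y = cinner x (blinfun_apply S y))"

definition star_homomorphism ::
    "'g groupoid_data \<Rightarrow> (('g \<Rightarrow> complex) \<Rightarrow> ('h::complex_hilbert \<Rightarrow>\<^sub>L 'h)) \<Rightarrow> bool"
  where "star_homomorphism G \<pi> \<longleftrightarrow>
    (\<forall>f \<in> conv_algebra G. \<pi> f \<in> bounded_operators) \<and>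
    (\<forall>f \<in> conv_algebra G. \<forall>g \<in> conv_algebra G. \<pi> (f + g) = \<pi> f + \<pi> g) \<and>
    (\<forall>c. \<forall>f \<in> conv_algebra G. \<forall>x.
      blinfun_apply (\<pi> (scale_fun c f)) x = c *\<^sub>C blinfun_apply (\<pi> f) x) \<and>
    (\<forall>f \<in> conv_algebra G. \<forall>g \<in> conv_algebra G. \<pi> (convolve G f g) = \<pi> f o\<^sub>L \<pi> g) \<and>
    (\<forall>f \<in> conv_algebra G. is_adjoint (\<pi> f) (\<pi> (involute G f)))"

end

theory Submission
  imports Defs
begin

text \<open>
  The constant is \<open>M = 1\<close>. For vectors \<open>\<xi>\<close> and \<open>\<eta>\<close> the \<open>*\<close>-homomorphism restricted to the unit space
  yields positive functionals \<open>g \<mapsto> \<langle>\<pi>(g)\<xi>, \<xi>\<rangle>\<close> and \<open>g \<mapsto> \<langle>\<pi>(g)\<eta>, \<eta>\<rangle>\<close> on \<open>C_c(G\<^sup>(\<^sup>0\<^sup>))\<close>, of total mass at most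
  \<open>\<parallel>\<xi>\<parallel>\<^sup>2\<close> and \<open>\<parallel>\<eta>\<parallel>\<^sup>2\<close> (\<open>positive_functional_vector\<close>). For \<open>h\<close> supported on one open bisection, writing
  \<open>h\<close> as a product of two functions of modulus \<open>|h|\<^sup>1\<^sup>/\<^sup>2\<close> bounds \<open>2 Re \<langle>\<pi>(h)\<xi>, \<eta>\<rangle>\<close> by the integral of the
  source fibre sums of \<open>|h|\<close> for \<open>\<xi>\<close> plus that of the range fibre sums for \<open>\<eta>\<close>
  (\<open>bisection_estimate\<close>).

  A general \<open>f\<close> is a sum of such functions \<open>h\<close>. If the sum of their moduli were \<open>|f|\<close>, adding up these
  bounds would give \<open>2 Re \<langle>\<pi>(f)\<xi>, \<eta>\<rangle> \<le> \<parallel>f\<parallel>\<^sub>I (\<parallel>\<xi>\<parallel>\<^sup>2 + \<parallel>\<eta>\<parallel>\<^sup>2)\<close>, and rescaling \<open>\<eta>\<close> would give the claim. On a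
  Hausdorff groupoid a partition of unity achieves this. In general \<open>f\<close> is not continuous, and one
  would have to cut it along Borel sets. Instead, the overlaps of the bisections are cut by
  continuous bumps that nearly exhaust them; then \<open>\<Sum>|h|\<close> exceeds \<open>|f|\<close> only by multiples of
  \<open>1\<^sub>W - \<psi>\<close>, where \<open>W\<close> is an intersection of two bisections and \<open>\<psi>\<close> a bump on it
  (\<open>almost_disjoint_pieces\<close>). The bumps can be chosen such that the images of \<open>1\<^sub>W - \<psi>\<close> under source
  and range have small integrals (\<open>near_maximal_bump\<close>), where the integral of the indicator of an
  open set is the supremum of the values of the functional on bumps inside it. A compactness
  argument shows that these suprema dominate as integrals should (\<open>le_mass_sum\<close>).
\<close>

section \<open>Compactly supported functions\<close>

text \<open>The condition that defines \<^const>\<open>C_c\<close>, for values in an arbitrary space with a zero: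
  the proof uses real-valued functions (bumps, absolute values) next to complex ones.\<close>

definition compactly_supported ::
    "'a topology \<Rightarrow> 'a set \<Rightarrow> ('a \<Rightarrow> 'b::{topological_space, zero}) \<Rightarrow> bool"
  where "compactly_supported T U f \<longleftrightarrow> continuous_map (subtopology T U) euclidean f \<and>
    (\<exists>K. compactin T K \<and> K \<subseteq> U \<and> (\<forall>x. x \<notin> K \<longrightarrow> f x = 0))"

lemma C_c_iff: "f \<in> C_c T U \<longleftrightarrow> compactly_supported T U f"
  by (simp add: C_c_def compactly_supported_def)

lemma compactly_supported_outside:
  "compactly_supported T U f \<Longrightarrow> x \<notin> U \<Longrightarrow> f x = 0"
  by (auto simp: compactly_supported_def)

lemma compactly_supported_0: "compactly_supported T U (\<lambda>x. 0)"
  by (auto simp: compactly_supported_def intro!: exI[of _ "{}"])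

lemma compactly_supported_comp:
  assumes "compactly_supported T U f" "continuous_on UNIV \<phi>" "\<phi> 0 = 0"
  shows "compactly_supported T U (\<lambda>x. \<phi> (f x))"
proof -
  have "continuous_map (subtopology T U) euclidean (\<phi> \<circ> f)"
    using assms by (intro continuous_map_compose[of _ euclidean]) (auto simp: compactly_supported_def)
  then show ?thesis using assms unfolding compactly_supported_def o_def by force
qed

lemma compactly_supported_of_real: "compactly_supported T U u \<Longrightarrow> compactly_supported T U (\<lambda>x. complex_of_real (u x))"
  by (erule compactly_supported_comp) (auto intro!: continuous_intros)

lemma compactly_supported_comp2:
  assumes f: "compactly_supported T U f" and g: "compactly_supported T U g"
    and \<phi>: "continuous_on UNIV (\<lambda>p. \<phi> (fst p) (snd p))" "\<phi> 0 0 = 0"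
  shows "compactly_supported T U (\<lambda>x. \<phi> (f x) (g x))"
proof -
  have "continuous_map (subtopology T U) (prod_topology euclidean euclidean) (\<lambda>x. (f x, g x))"
    using f g by (intro continuous_map_pairedI) (auto simp: compactly_supported_def)
  then have "continuous_map (subtopology T U) euclidean (\<lambda>x. (f x, g x))"
    by (simp only: prod_topology_euclidean)
  then have "continuous_map (subtopology T U) euclidean ((\<lambda>p. \<phi> (fst p) (snd p)) \<circ> (\<lambda>x. (f x, g x)))"
    using \<phi> by (intro continuous_map_compose[of _ euclidean]) auto
  moreover obtain K L where "compactin T K" "K \<subseteq> U" "\<forall>x. x \<notin> K \<longrightarrow> f x = 0"
    "compactin T L" "L \<subseteq> U" "\<forall>x. x \<notin> L \<longrightarrow> g x = 0"
    using f g by (auto simp: compactly_supported_def)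
  then have "compactin T (K \<union> L) \<and> K \<union> L \<subseteq> U \<and> (\<forall>x. x \<notin> K \<union> L \<longrightarrow> \<phi> (f x) (g x) = 0)"
    using \<phi>(2) by (auto simp: compactin_Un)
  ultimately show ?thesis by (auto simp: compactly_supported_def o_def)
qed

lemma compactly_supported_add:
  fixes f g :: "'a \<Rightarrow> 'b::topological_monoid_add"
  shows "compactly_supported T U f \<Longrightarrow> compactly_supported T U g \<Longrightarrow>
    compactly_supported T U (\<lambda>x. f x + g x)"
  by (erule compactly_supported_comp2[where \<phi> = "(+)"], assumption) (auto intro!: continuous_intros)

lemma compactly_supported_sum_list:
  fixes F :: "'i \<Rightarrow> 'a \<Rightarrow> 'b::topological_monoid_add"
  assumes "\<And>i. i \<in> set xs \<Longrightarrow> compactly_supported T U (F i)"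
  shows "compactly_supported T U (\<lambda>x. \<Sum>i\<leftarrow>xs. F i x)"
  using assms by (induction xs) (auto intro!: compactly_supported_0 compactly_supported_add)

text \<open>This is how mass is moved between two bisections: multiplication by a bump that lives on their
  intersection turns an element of \<open>C_c(U)\<close> into one that may equally be regarded as supported on the
  other bisection.\<close>

lemma compactly_supported_mult_restrict:
  fixes f :: "'a \<Rightarrow> complex" and \<psi> :: "'a \<Rightarrow> real"
  assumes f: "compactly_supported T U f" and \<psi>: "compactly_supported T W \<psi>" and "W \<subseteq> U"
  shows "compactly_supported T W (\<lambda>x. of_real (\<psi> x) * f x)"
proof -
  have "continuous_map (subtopology T W) euclidean f"
    using f \<open>W \<subseteq> U\<close> continuous_map_from_subtopology_mono by (auto simp: compactly_supported_def)
  moreover have "continuous_map (subtopology T W) euclideanreal \<psi>"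
    using \<psi> by (auto simp: compactly_supported_def)
  ultimately have "continuous_map (subtopology T W) (prod_topology euclidean euclidean) (\<lambda>x. (\<psi> x, f x))"
    by (intro continuous_map_pairedI)
  then have "continuous_map (subtopology T W) euclidean (\<lambda>x. (\<psi> x, f x))"
    by (simp only: prod_topology_euclidean)
  then have "continuous_map (subtopology T W) euclidean
      ((\<lambda>p. of_real (fst p) * snd p) \<circ> (\<lambda>x. (\<psi> x, f x)))"
    by (intro continuous_map_compose[of _ euclidean]) (auto intro!: continuous_intros)
  then show ?thesis using \<psi> unfolding compactly_supported_def o_def fst_conv snd_conv
    by force
qed

text \<open>Extension by zero is continuous because the support is compact, hence closed in the Hausdorff set
  \<open>U\<close>. In the whole space compact sets need not be closed, which is why elements of the convolution
  algebra need not be continuous.\<close>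

lemma compactly_supported_mono:
  assumes f: "compactly_supported T W f" and "W \<subseteq> U" and W: "openin T W" and U: "openin T U"
    and H: "Hausdorff_space (subtopology T U)"
  shows "compactly_supported T U f"
proof -
  obtain K where K: "compactin T K" "K \<subseteq> W" "\<And>x. x \<notin> K \<Longrightarrow> f x = 0"
    and cont: "continuous_map (subtopology T W) euclidean f"
    using f by (auto simp: compactly_supported_def)
  have "compactin (subtopology T U) K" using K \<open>W \<subseteq> U\<close> by (auto simp: compactin_subtopology)
  then have "closedin (subtopology T U) K" using H compactin_imp_closedin by blast
  then have "openin (subtopology T U) (topspace (subtopology T U) - K)" by blast
  then have op: "openin T (U - K)"
    using U openin_subset[OF U] by (auto simp: openin_open_subtopology Int_absorb1)
  have "continuous_map (subtopology T U) euclidean f"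
  proof (rule pasting_lemma[where I = "{W, U - K}" and T = "\<lambda>S. S" and f = "\<lambda>_. f"])
    fix S assume "S \<in> {W, U - K}"
    then show "openin (subtopology T U) S"
      using W op U \<open>W \<subseteq> U\<close> by (auto simp: openin_open_subtopology)
    have "continuous_map (subtopology T (U - K)) euclidean f"
      by (rule continuous_map_eq[of _ _ "\<lambda>_. 0"]) (use K in auto)
    then show "continuous_map (subtopology (subtopology T U) S) euclidean f"
      using \<open>S \<in> _\<close> cont \<open>W \<subseteq> U\<close>
      by (auto simp: subtopology_subtopology Int_absorb1 Int_absorb2 Int_Diff)
  qed (use \<open>K \<subseteq> W\<close> in auto)
  then show ?thesis using K \<open>W \<subseteq> U\<close> by (auto simp: compactly_supported_def)
qed

lemma compactly_supported_bounded:
  fixes f :: "'a \<Rightarrow> 'b::real_normed_vector"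
  assumes "compactly_supported T U f"
  shows "\<exists>B\<ge>0. \<forall>x. norm (f x) \<le> B"
proof -
  obtain K where K: "compactin T K" "K \<subseteq> U" "\<And>x. x \<notin> K \<Longrightarrow> f x = 0"
    and cont: "continuous_map (subtopology T U) euclidean f"
    using assms by (auto simp: compactly_supported_def)
  have "compactin (subtopology T U) K" using K by (auto simp: compactin_subtopology)
  then have "compact (f ` K)" using cont image_compactin by fastforce
  then obtain B where "\<And>y. y \<in> f ` K \<Longrightarrow> norm y \<le> B" using compact_imp_bounded bounded_iff by metis
  then have "norm (f x) \<le> max 0 B" for x using K(3)[of x] by (cases "x \<in> K") (auto intro: max.coboundedI2)
  then show ?thesis by (meson max.cobounded1)
qed

text \<open>An open Hausdorff subset is a locally compact Hausdorff space, hence completely regular, so that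
  Urysohn's lemma applies inside it.\<close>

lemma compactly_supported_bump:
  assumes LC: "locally_compact T" and U: "openin T U" and H: "Hausdorff_space (subtopology T U)"
    and K: "compactin T K" "K \<subseteq> U"
  obtains \<theta> :: "'a \<Rightarrow> real" where "compactly_supported T U \<theta>" "\<And>x. 0 \<le> \<theta> x" "\<And>x. \<theta> x \<le> 1"
    "\<And>x. x \<in> K \<Longrightarrow> \<theta> x = 1"
proof -
  let ?S = "subtopology T U"
  have tS: "topspace ?S = U" using openin_subset[OF U] by auto
  have "neighbourhood_base_of (compactin T) T" using LC by (simp add: locally_compact_def)
  then have "\<exists>V C. openin T V \<and> compactin T C \<and> x \<in> V \<and> V \<subseteq> C \<and> C \<subseteq> U" if "x \<in> U" for x
    using U that by (auto simp: neighbourhood_base_of)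
  then have "\<exists>V C. openin ?S V \<and> compactin ?S C \<and> x \<in> V \<and> V \<subseteq> C" if "x \<in> U" for x
    using that U by (force simp: compactin_subtopology openin_open_subtopology)
  then have lcS: "locally_compact_space ?S" using tS by (auto simp: locally_compact_space_def)
  have "regular_space ?S" by (rule locally_compact_Hausdorff_imp_regular_space[OF lcS H])
  then have cr: "completely_regular_space ?S"
    using lcS locally_compact_regular_imp_completely_regular_space by blast
  have KS: "compactin ?S K" using K by (simp add: compactin_subtopology)
  obtain V C where VC: "openin ?S V" "compactin ?S C" "K \<subseteq> V" "V \<subseteq> C"
    using locally_compact_space_compact_closed_compact[of ?S] lcS H KS by blast
  have "closedin ?S (U - V)" using closedin_diff[OF closedin_topspace VC(1)] tS by simp
  moreover have "disjnt (U - V) K" using VC by (auto simp: disjnt_def)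
  ultimately obtain f where f: "continuous_map ?S (top_of_set {0..1}) f" "f ` (U - V) \<subseteq> {0}" "f ` K \<subseteq> {1::real}"
    by (rule_tac Urysohn_completely_regular_compact_closed[OF zero_le_one cr KS, of "U - V"])
      (auto simp: disjnt_sym)
  define \<theta> where "\<theta> x = (if x \<in> U then f x else 0)" for x
  have fr: "x \<in> U \<Longrightarrow> f x \<in> {0..1}" for x
    using f(1) tS by (auto simp: continuous_map_in_subtopology)
  show ?thesis
  proof
    have "continuous_map ?S euclidean \<theta>"
      by (rule continuous_map_eq[of _ _ f])
        (use f tS in \<open>auto simp: \<theta>_def continuous_map_in_subtopology\<close>)
    moreover have "compactin T C" "C \<subseteq> U" using VC by (auto simp: compactin_subtopology)
    moreover have "x \<notin> C \<Longrightarrow> \<theta> x = 0" for x using f(2) VC by (auto simp: \<theta>_def)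
    ultimately show "compactly_supported T U \<theta>" unfolding compactly_supported_def by blast
    show "0 \<le> \<theta> x" "\<theta> x \<le> 1" for x using fr[of x] by (auto simp: \<theta>_def)
    show "x \<in> K \<Longrightarrow> \<theta> x = 1" for x using f(3) K by (auto simp: \<theta>_def)
  qed
qed

section \<open>Positive functionals and the mass of open sets\<close>

definition bumps :: "'a topology \<Rightarrow> 'a set \<Rightarrow> ('a \<Rightarrow> real) set"
  where "bumps T V = {\<theta>. compactly_supported T V \<theta> \<and> (\<forall>x. 0 \<le> \<theta> x \<and> \<theta> x \<le> 1)}"

lemma bumps_upper_bound:
  assumes "finite F" "\<And>i. i \<in> F \<Longrightarrow> \<phi> i \<in> bumps T V"
  shows "\<exists>\<theta>\<in>bumps T V. \<forall>i\<in>F. \<forall>x. \<phi> i x \<le> \<theta> x"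
  using assms
proof (induction F)
  case empty
  have "(\<lambda>x. 0) \<in> bumps T V" by (simp add: bumps_def compactly_supported_0)
  then show ?case by blast
next
  case (insert i F)
  then obtain \<theta> where \<theta>: "\<theta> \<in> bumps T V" "\<And>j x. j \<in> F \<Longrightarrow> \<phi> j x \<le> \<theta> x" by blast
  have i: "\<phi> i \<in> bumps T V" using insert.prems by simp
  have "compactly_supported T V (\<lambda>x. max (\<phi> i x) (\<theta> x))"
    by (rule compactly_supported_comp2[where \<phi> = max])
      (use i \<theta> in \<open>auto simp: bumps_def intro!: continuous_intros\<close>)
  then have "(\<lambda>x. max (\<phi> i x) (\<theta> x)) \<in> bumps T V"
    using i \<theta>(1) by (auto simp: bumps_def le_max_iff_disj)
  moreover have "\<forall>j\<in>insert i F. \<forall>x. \<phi> j x \<le> max (\<phi> i x) (\<theta> x)"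
    using \<theta>(2) by (auto simp: le_max_iff_disj)
  ultimately show ?case by (intro bexI[of _ "\<lambda>x. max (\<phi> i x) (\<theta> x)"])
qed

text \<open>A positive functional on \<open>C_c(X)\<close> with total mass at most \<open>m\<close>, for an open Hausdorff subset \<open>X\<close> of
  a larger space. By the Riesz theorem it is integration against a measure of which only the values on
  open sets are needed below, and those are given by an explicit supremum.\<close>

locale positive_functional =
  fixes T :: "'a topology" and X :: "'a set" and L :: "('a \<Rightarrow> real) \<Rightarrow> real" and m :: real
  assumes open_X: "openin T X"
    and Hausdorff_X: "Hausdorff_space (subtopology T X)"
    and loc_compact: "locally_compact T"
    and add: "compactly_supported T X u \<Longrightarrow> compactly_supported T X v \<Longrightarrow>
      L (\<lambda>x. u x + v x) = L u + L v"
    and scale: "compactly_supported T X u \<Longrightarrow> L (\<lambda>x. a * u x) = a * L u"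
    and nonneg: "compactly_supported T X u \<Longrightarrow> (\<And>x. 0 \<le> u x) \<Longrightarrow> 0 \<le> L u"
    and bound: "u \<in> bumps T X \<Longrightarrow> L u \<le> m"
begin

definition mass :: "'a set \<Rightarrow> real"
  where "mass V = Sup (L ` bumps T V)"

lemma compactly_supported_extend: "compactly_supported T V f \<Longrightarrow> openin T V \<Longrightarrow> V \<subseteq> X \<Longrightarrow> compactly_supported T X f"
  using compactly_supported_mono Hausdorff_X open_X by blast

lemma compactly_supported_scale: "compactly_supported T X u \<Longrightarrow> compactly_supported T X (\<lambda>x. (a::real) * u x)"
  by (rule compactly_supported_comp[where \<phi> = "\<lambda>y. a * y"]) (auto intro!: continuous_intros)

lemma zero: "L (\<lambda>x. 0) = 0"
  using scale[of "\<lambda>x. 0" 0] by (simp add: compactly_supported_0)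

lemma m_nonneg: "0 \<le> m"
  using bound[of "\<lambda>x. 0"] by (simp add: bumps_def compactly_supported_0 zero)

lemma mono:
  assumes u: "compactly_supported T X u" and v: "compactly_supported T X v" and le: "\<And>x. u x \<le> v x"
  shows "L u \<le> L v"
proof -
  let ?d = "\<lambda>x. v x + (-1) * u x"
  have "compactly_supported T X ?d" by (intro compactly_supported_add compactly_supported_scale u v)
  then have "0 \<le> L ?d" by (rule nonneg) (simp add: le)
  also have "L ?d = L v + (-1) * L u" by (simp only: add[OF v compactly_supported_scale[OF u]] scale[OF u])
  finally show ?thesis by simp
qed

lemma sum_list:
  assumes "\<And>i. i \<in> set xs \<Longrightarrow> compactly_supported T X (F i)"
  shows "L (\<lambda>x. \<Sum>i\<leftarrow>xs. F i x) = (\<Sum>i\<leftarrow>xs. L (F i))"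
  using assms
  by (induction xs) (auto simp: zero add compactly_supported_sum_list)

lemma le_mass:
  assumes "openin T V" "V \<subseteq> X" "\<theta> \<in> bumps T V"
  shows "L \<theta> \<le> mass V"
  unfolding mass_def
proof (rule cSup_upper)
  show "bdd_above (L ` bumps T V)"
    using assms compactly_supported_extend by (intro bdd_aboveI[of _ m]) (auto simp: bumps_def intro!: bound)
qed (use assms in simp)

lemma mass_approx:
  assumes "0 < \<epsilon>"
  obtains \<theta> where "\<theta> \<in> bumps T V" "mass V - \<epsilon> < L \<theta>"
proof -
  have "(\<lambda>x. 0) \<in> bumps T V" by (simp add: bumps_def compactly_supported_0)
  then have "\<exists>y\<in>L ` bumps T V. mass V - \<epsilon> < y"
    using assms unfolding mass_def by (intro less_cSupD) auto
  then show ?thesis using that by blast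
qed

text \<open>Integrating a pointwise bound in which indicators of open sets occur. These indicators are lower
  semicontinuous, so the bound cannot be fed to \<open>L\<close>; but on the compact support of \<open>u\<close> it persists, up
  to \<open>\<delta>\<close>, when each indicator is replaced by one sufficiently large bump (a Dini argument).\<close>

lemma le_mass_sum:
  fixes a c :: real
  assumes u: "compactly_supported T X u"
    and vs: "\<And>V. V \<in> set vs \<Longrightarrow> openin T V \<and> V \<subseteq> X"
    and a: "0 \<le> a" and c: "0 \<le> c"
    and le: "\<And>x. x \<in> X \<Longrightarrow> u x \<le> c + a * (\<Sum>V\<leftarrow>vs. indicator V x)"
  shows "L u \<le> c * m + a * (\<Sum>V\<leftarrow>vs. mass V)"
proof (rule field_le_epsilon)
  fix e :: real assume e: "0 < e"
  define \<delta> where "\<delta> = e / (m + 1)"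
  have \<delta>: "0 < \<delta>" "\<delta> * m \<le> e" using m_nonneg e by (auto simp: \<delta>_def field_simps)
  obtain K where K: "compactin T K" "K \<subseteq> X" "\<And>x. x \<notin> K \<Longrightarrow> u x = 0"
    using u by (auto simp: compactly_supported_def)
  \<comment> \<open>Near a given point, bumps that equal 1 at that point are large enough.\<close>
  have "\<exists>\<phi>. \<forall>V\<in>set vs. \<phi> V \<in> bumps T V \<and> (x \<in> V \<longrightarrow> \<phi> V x = 1)" for x
  proof (intro bchoice ballI)
    fix V assume V: "V \<in> set vs"
    have H: "Hausdorff_space (subtopology T V)"
      using Hausdorff_space_subtopology[OF Hausdorff_X, of V] vs[OF V]
      by (simp add: subtopology_subtopology Int_absorb1)
    have "compactin T ({x} \<inter> V)"
      using vs[OF V] openin_subset by (cases "x \<in> V") auto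
    then obtain \<chi>' :: "'a \<Rightarrow> real" where "compactly_supported T V \<chi>'" "\<And>y. 0 \<le> \<chi>' y" "\<And>y. \<chi>' y \<le> 1"
        "\<And>y. y \<in> {x} \<inter> V \<Longrightarrow> \<chi>' y = 1"
      using compactly_supported_bump[OF loc_compact _ H] vs[OF V] by (metis inf_le2)
    then show "\<exists>y. y \<in> bumps T V \<and> (x \<in> V \<longrightarrow> y x = 1)" by (auto simp: bumps_def)
  qed
  then obtain \<phi> where \<phi>: "\<And>x V. V \<in> set vs \<Longrightarrow> \<phi> x V \<in> bumps T V"
      "\<And>x V. V \<in> set vs \<Longrightarrow> x \<in> V \<Longrightarrow> \<phi> x V x = 1" by metis
  have cs\<phi>: "V \<in> set vs \<Longrightarrow> compactly_supported T X (\<phi> x V)" for x V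
    using compactly_supported_extend[of V "\<phi> x V"] \<phi>(1)[of V x] vs[of V] by (simp add: bumps_def)
  define N where "N x = {y \<in> X. u y + (-a) * (\<Sum>V\<leftarrow>vs. \<phi> x V y) \<in> {..<c + \<delta>}}" for x
  have N_open: "openin T (N x)" for x
  proof -
    have "compactly_supported T X (\<lambda>y. u y + (-a) * (\<Sum>V\<leftarrow>vs. \<phi> x V y))"
      by (intro compactly_supported_add compactly_supported_scale compactly_supported_sum_list u cs\<phi>)
    then have "openin (subtopology T X) {y \<in> topspace (subtopology T X).
        u y + (-a) * (\<Sum>V\<leftarrow>vs. \<phi> x V y) \<in> {..<c + \<delta>}}"
      unfolding compactly_supported_def by (intro openin_continuous_map_preimage) auto
    then show ?thesis
      using open_X openin_subset[OF open_X] by (simp add: N_def openin_open_subtopology Int_absorb1)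
  qed
  have N_mem: "x \<in> N x" if "x \<in> K" for x
  proof -
    have "(\<Sum>V\<leftarrow>vs. indicator V x) \<le> (\<Sum>V\<leftarrow>vs. \<phi> x V x)"
      by (rule sum_list_mono) (use \<phi> in \<open>auto simp: bumps_def indicator_def\<close>)
    then have "a * (\<Sum>V\<leftarrow>vs. indicator V x) \<le> a * (\<Sum>V\<leftarrow>vs. \<phi> x V x)" using a by (rule mult_left_mono)
    then show ?thesis using le[of x] that K(2) \<delta>(1) by (auto simp: N_def)
  qed
  have "\<exists>\<F>. finite \<F> \<and> \<F> \<subseteq> N ` K \<and> K \<subseteq> \<Union>\<F>"
    using K(1) N_open N_mem unfolding compactin_def by (auto dest!: spec[of _ "N ` K"])
  then obtain F where F: "finite F" "F \<subseteq> K" "K \<subseteq> \<Union>(N ` F)"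
    by (metis finite_subset_image)
  have "\<forall>V\<in>set vs. \<exists>\<theta>\<in>bumps T V. \<forall>x\<in>F. \<forall>y. \<phi> x V y \<le> \<theta> y"
    by (intro ballI bumps_upper_bound[OF F(1)] \<phi>(1))
  then obtain \<theta> where \<theta>: "\<And>V. V \<in> set vs \<Longrightarrow> \<theta> V \<in> bumps T V"
      "\<And>V x y. V \<in> set vs \<Longrightarrow> x \<in> F \<Longrightarrow> \<phi> x V y \<le> \<theta> V y"
    using bchoice[of "set vs" "\<lambda>V \<theta>. \<theta> \<in> bumps T V \<and> (\<forall>x\<in>F. \<forall>y. \<phi> x V y \<le> \<theta> y)"] by blast
  have cs\<theta>: "V \<in> set vs \<Longrightarrow> compactly_supported T X (\<theta> V)" for V
    using compactly_supported_extend[of V "\<theta> V"] \<theta>(1)[of V] vs[of V] by (simp add: bumps_def)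
  obtain \<kappa> :: "'a \<Rightarrow> real" where \<kappa>: "compactly_supported T X \<kappa>" "\<And>x. 0 \<le> \<kappa> x" "\<And>x. \<kappa> x \<le> 1"
    "\<And>x. x \<in> K \<Longrightarrow> \<kappa> x = 1"
    using compactly_supported_bump[OF loc_compact open_X Hausdorff_X K(1,2)] by metis
  have pointwise: "u y \<le> (c + \<delta>) * \<kappa> y + a * (\<Sum>V\<leftarrow>vs. \<theta> V y)" for y
  proof (cases "y \<in> K")
    case True
    then obtain x where x: "x \<in> F" "y \<in> N x" using F(3) by blast
    have "(\<Sum>V\<leftarrow>vs. \<phi> x V y) \<le> (\<Sum>V\<leftarrow>vs. \<theta> V y)" by (rule sum_list_mono) (use \<theta> x in auto)
    then have "a * (\<Sum>V\<leftarrow>vs. \<phi> x V y) \<le> a * (\<Sum>V\<leftarrow>vs. \<theta> V y)" using a by (rule mult_left_mono)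
    then show ?thesis using x(2) \<kappa>(4)[OF True] by (auto simp: N_def)
  next
    case False
    have "0 \<le> (\<Sum>V\<leftarrow>vs. \<theta> V y)" by (rule sum_list_nonneg) (use \<theta>(1) in \<open>auto simp: bumps_def\<close>)
    then show ?thesis using K(3)[OF False] a c \<delta>(1) \<kappa>(2) by simp
  qed
  have cs1: "compactly_supported T X (\<lambda>y. (c + \<delta>) * \<kappa> y)" by (intro compactly_supported_scale \<kappa>)
  have cs2: "compactly_supported T X (\<lambda>y. \<Sum>V\<leftarrow>vs. \<theta> V y)"
    by (intro compactly_supported_sum_list cs\<theta>)
  have "L u \<le> L (\<lambda>y. (c + \<delta>) * \<kappa> y + a * (\<Sum>V\<leftarrow>vs. \<theta> V y))"
    by (intro mono u compactly_supported_add cs1 compactly_supported_scale cs2 pointwise)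
  also have "\<dots> = (c + \<delta>) * L \<kappa> + a * (\<Sum>V\<leftarrow>vs. L (\<theta> V))"
    by (simp only: add[OF cs1 compactly_supported_scale[OF cs2]] scale[OF \<kappa>(1)] scale[OF cs2] sum_list[OF cs\<theta>])
  also have "\<dots> \<le> (c + \<delta>) * m + a * (\<Sum>V\<leftarrow>vs. mass V)"
  proof (intro add_mono mult_left_mono sum_list_mono)
    show "L \<kappa> \<le> m" using \<kappa> by (intro bound) (auto simp: bumps_def)
    show "L (\<theta> V) \<le> mass V" if "V \<in> set vs" for V
      using le_mass vs[OF that] \<theta>(1)[OF that] by blast
  qed (use a c \<delta>(1) in auto)
  also have "\<dots> \<le> c * m + a * (\<Sum>V\<leftarrow>vs. mass V) + e" using \<delta>(2) by (simp add: algebra_simps)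
  finally show "L u \<le> c * m + a * (\<Sum>V\<leftarrow>vs. mass V) + e" .
qed

end

section \<open>Push-forward along an injective open map\<close>

definition push :: "('a \<Rightarrow> 'a) \<Rightarrow> 'a set \<Rightarrow> ('a \<Rightarrow> 'b::zero) \<Rightarrow> 'a \<Rightarrow> 'b"
  where "push p U u = (\<lambda>x. if x \<in> p ` U then u (the_inv_into U p x) else 0)"

lemma push_eq: "inj_on p U \<Longrightarrow> a \<in> U \<Longrightarrow> push p U u (p a) = u a"
  by (auto simp: push_def the_inv_into_f_f)

lemma push_outside: "x \<notin> p ` U \<Longrightarrow> push p U u x = 0"
  by (simp add: push_def)

text \<open>The push-forward is summation over the fibre. Taking a fibre sum over a set \<open>F\<close> that does not depend on
  \<open>U\<close> allows the push-forwards from several sets \<open>U\<close> to be compared termwise.\<close>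

lemma push_eq_sum:
  assumes inj: "inj_on p U" and fin: "finite F" and F: "\<And>a. a \<in> F \<Longrightarrow> p a = x" "\<And>a. a \<in> U \<Longrightarrow> p a = x \<Longrightarrow> a \<in> F"
    and u: "\<And>a. a \<notin> U \<Longrightarrow> u a = 0"
  shows "push p U u x = (\<Sum>a\<in>F. u a)"
proof (cases "x \<in> p ` U")
  case True
  then obtain a where a: "a \<in> U" "x = p a" by blast
  have "(\<Sum>b\<in>F. u b) = (\<Sum>b\<in>{a}. u b)"
  proof (rule sum.mono_neutral_right[OF fin])
    show "{a} \<subseteq> F" using F(2) a by auto
    show "\<forall>b\<in>F - {a}. u b = 0" using F(1) a inj u by (metis DiffE inj_onD singletonI)
  qed
  then show ?thesis using a push_eq[OF inj] by auto
next
  case False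
  then have "(\<Sum>b\<in>F. u b) = 0" using F(1) u by (intro sum.neutral) blast
  then show ?thesis using False by (simp add: push_outside)
qed

context
  fixes T :: "'a topology" and U :: "'a set" and p :: "'a \<Rightarrow> 'a"
  assumes U: "openin T U" and cont: "continuous_map T T p" and op: "open_map T T p" and inj: "inj_on p U"
begin

lemma push_homeomorphic_maps:
  "homeomorphic_maps (subtopology T U) (subtopology T (p ` U)) p (the_inv_into U p)"
proof -
  have tU: "topspace (subtopology T U) = U" using openin_subset[OF U] by auto
  have pU: "openin T (p ` U)" using op U by (simp add: open_map_def)
  have tpU: "topspace (subtopology T (p ` U)) = p ` U" using openin_subset[OF pU] by auto
  have "homeomorphic_map (subtopology T U) (subtopology T (p ` U)) p"
  proof (rule bijective_open_imp_homeomorphic_map)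
    show "continuous_map (subtopology T U) (subtopology T (p ` U)) p"
      using cont tU by (auto simp: continuous_map_in_subtopology continuous_map_from_subtopology)
    show "open_map (subtopology T U) (subtopology T (p ` U)) p"
      using op U pU by (auto simp: open_map_def openin_open_subtopology)
  qed (use tU tpU inj in auto)
  then obtain g where g: "homeomorphic_maps (subtopology T U) (subtopology T (p ` U)) p g"
    using homeomorphic_map_maps by blast
  have "g x = the_inv_into U p x" if "x \<in> p ` U" for x
    using g that tU tpU inj by (auto simp: homeomorphic_maps_def the_inv_into_f_f)
  then show ?thesis using g tU tpU
    by (intro homeomorphic_maps_eq[OF g]) auto
qed

lemma push_compactly_supported:
  fixes u :: "'a \<Rightarrow> 'b::{topological_space, zero}"
  assumes u: "compactly_supported T U u"
  shows "compactly_supported T (p ` U) (push p U u)"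
proof -
  obtain K where K: "compactin T K" "K \<subseteq> U" "\<And>x. x \<notin> K \<Longrightarrow> u x = 0"
    using u by (auto simp: compactly_supported_def)
  have "continuous_map (subtopology T (p ` U)) (subtopology T U) (the_inv_into U p)"
    using push_homeomorphic_maps by (simp add: homeomorphic_maps_def)
  then have "continuous_map (subtopology T (p ` U)) euclidean (u \<circ> the_inv_into U p)"
    using u continuous_map_compose by (auto simp: compactly_supported_def)
  then have "continuous_map (subtopology T (p ` U)) euclidean (push p U u)"
    by (rule continuous_map_eq) (auto simp: push_def)
  moreover have "compactin T (p ` K)" using K cont image_compactin by blast
  moreover have "push p U u x = 0" if x: "x \<notin> p ` K" for x
    using imageI[of _ K p] K(3) x by (cases "x \<in> p ` U") (force simp: push_outside push_eq[OF inj])+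
  ultimately show ?thesis using K(2) unfolding compactly_supported_def by blast
qed

lemma push_bumps_surj:
  assumes \<theta>: "\<theta> \<in> bumps T (p ` U)"
  obtains \<psi> where "\<psi> \<in> bumps T U" "push p U \<psi> = \<theta>"
proof
  define \<psi> where "\<psi> a = (if a \<in> U then \<theta> (p a) else 0)" for a
  have cs: "compactly_supported T (p ` U) \<theta>" using \<theta> by (simp add: bumps_def)
  then obtain K where K: "compactin T K" "K \<subseteq> p ` U" "\<And>x. x \<notin> K \<Longrightarrow> \<theta> x = 0"
    by (auto simp: compactly_supported_def)
  note hom = push_homeomorphic_maps[unfolded homeomorphic_maps_def]
  have "continuous_map (subtopology T U) euclidean (\<theta> \<circ> p)"
    using hom cs continuous_map_compose by (auto simp: compactly_supported_def)
  then have "continuous_map (subtopology T U) euclidean \<psi>"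
    by (rule continuous_map_eq) (auto simp: \<psi>_def)
  moreover have "compactin (subtopology T (p ` U)) K" using K by (simp add: compactin_subtopology)
  then have "compactin (subtopology T U) (the_inv_into U p ` K)"
    using hom image_compactin by blast
  then have "compactin T (the_inv_into U p ` K)" "the_inv_into U p ` K \<subseteq> U"
    by (auto simp: compactin_subtopology)
  moreover have "\<psi> a = 0" if "a \<notin> the_inv_into U p ` K" for a
  proof (cases "a \<in> U")
    case True
    then have "p a \<notin> K" using that the_inv_into_f_f[OF inj True] by force
    then show ?thesis using K(3) by (simp add: \<psi>_def)
  qed (simp add: \<psi>_def)
  ultimately have "compactly_supported T U \<psi>" unfolding compactly_supported_def by blast
  then show "\<psi> \<in> bumps T U" using \<theta> by (auto simp: bumps_def \<psi>_def)
  show "push p U \<psi> = \<theta>"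
  proof
    fix x show "push p U \<psi> x = \<theta> x"
      using push_eq[OF inj, where u = \<psi>] K(2) K(3)[of x]
      by (cases "x \<in> p ` U") (auto simp: push_outside \<psi>_def)
  qed
qed

end

section \<open>Etale groupoids and their open bisections\<close>

locale lc_etale_groupoid = etale_groupoid G for G :: "'g groupoid_data" +
  assumes loc_compact: "locally_compact (gtop G)"
    and Hausdorff_units: "Hausdorff_space (unit_topology G)"

context etale_groupoid
begin

lemma src_in_units: "a \<in> arrows G \<Longrightarrow> src G a \<in> unit_space G"
  by (simp add: unit_space_def)

lemma units_subset: "unit_space G \<subseteq> arrows G"
  using src_in by (auto simp: unit_space_def)

lemma src_src: "a \<in> arrows G \<Longrightarrow> src G (src G a) = src G a"
  using src_in_units src_unit by blast

lemma inv_inv: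
  assumes a: "a \<in> arrows G" shows "ginv G (ginv G a) = a"
proof -
  let ?i = "ginv G a"
  have i: "?i \<in> arrows G" "ginv G ?i \<in> arrows G" using a inv_in by auto
  have c: "(ginv G ?i, ?i) \<in> composable G" "(?i, a) \<in> composable G"
    using a i by (auto simp: composable_def src_inv rng_inv)
  have "ginv G ?i = gmul G (ginv G ?i) (src G (ginv G ?i))" using mul_src[OF i(2)] by simp
  also have "\<dots> = gmul G (ginv G ?i) (gmul G ?i a)" using a i by (simp add: src_inv rng_inv inv_mul)
  also have "\<dots> = gmul G (gmul G (ginv G ?i) ?i) a" using mul_assoc[OF c] by simp
  also have "\<dots> = gmul G (rng G a) a" using a i by (simp add: inv_mul src_inv)
  also have "\<dots> = a" using a by (rule rng_mul_self)
  finally show ?thesis .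
qed

lemma inv_unit:
  assumes x: "x \<in> unit_space G" shows "ginv G x = x"
proof -
  have xa: "x \<in> arrows G" using x units_subset by blast
  have "src G (ginv G x) = x" using xa x by (simp add: src_inv rng_unit)
  then have "ginv G x = gmul G (ginv G x) x" using mul_src[OF inv_in[OF xa]] by simp
  also have "\<dots> = x" using inv_mul[OF xa] x by (simp add: src_unit)
  finally show ?thesis .
qed

lemma continuous_src: "continuous_map (gtop G) (gtop G) (src G)"
proof -
  have "continuous_map (gtop G) (prod_topology (gtop G) (gtop G)) (\<lambda>a. (ginv G a, a))"
    by (intro continuous_map_pairedI continuous_inv) auto
  then have "continuous_map (gtop G) (subtopology (prod_topology (gtop G) (gtop G)) (composable G)) (\<lambda>a. (ginv G a, a))"
    by (auto simp: continuous_map_in_subtopology composable_def inv_in src_inv)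
  then have "continuous_map (gtop G) (gtop G) ((\<lambda>(a, b). gmul G a b) \<circ> (\<lambda>a. (ginv G a, a)))"
    using continuous_mul continuous_map_compose by blast
  then show ?thesis by (rule continuous_map_eq) (simp add: inv_mul)
qed

lemma continuous_rng: "continuous_map (gtop G) (gtop G) (rng G)"
proof -
  have "continuous_map (gtop G) (gtop G) (src G \<circ> ginv G)"
    using continuous_src continuous_inv continuous_map_compose by blast
  then show ?thesis by (rule continuous_map_eq) (simp add: src_inv)
qed

lemma locally_injective_src:
  assumes "a \<in> arrows G"
  obtains U where "openin (gtop G) U" "a \<in> U" "inj_on (src G) U"
proof -
  obtain U where U: "openin (gtop G) U" "a \<in> U"
      "homeomorphic_map (subtopology (gtop G) U) (subtopology (unit_topology G) (src G ` U)) (src G)"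
    using src_local_homeomorphism assms by (auto simp: local_homeomorphism_def)
  have "inj_on (src G) (topspace (subtopology (gtop G) U))"
    using U(3) homeomorphic_imp_injective_map by blast
  then have "inj_on (src G) U" using openin_subset[OF U(1)] by (simp add: Int_absorb1)
  then show ?thesis using U that by blast
qed

text \<open>Where \<open>src\<close> is injective on \<open>U\<close>, an arrow \<open>a \<in> U\<close> with \<open>src a \<in> U\<close> has the same source as the unit
  \<open>src a\<close> and so equals it.\<close>

lemma openin_units: "openin (gtop G) (unit_space G)"
proof (subst openin_subopen, intro ballI)
  fix x assume x: "x \<in> unit_space G"
  then obtain U where U: "openin (gtop G) U" "x \<in> U" "inj_on (src G) U"
    using locally_injective_src units_subset by blast
  define V where "V = U \<inter> {a \<in> arrows G. src G a \<in> U}"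
  have "openin (gtop G) V"
    unfolding V_def using U continuous_src by (intro openin_Int openin_continuous_map_preimage)
  moreover have "x \<in> V" using x U units_subset src_unit by (auto simp: V_def)
  moreover have "V \<subseteq> unit_space G"
  proof
    fix a assume a: "a \<in> V"
    then have "src G a = a" using U(3) src_src by (auto simp: V_def inj_on_def)
    then show "a \<in> unit_space G" using a src_in_units by (force simp: V_def)
  qed
  ultimately show "\<exists>V. openin (gtop G) V \<and> x \<in> V \<and> V \<subseteq> unit_space G" by blast
qed

lemma open_map_src: "open_map (gtop G) (gtop G) (src G)"
  unfolding open_map_def
proof (intro allI impI)
  fix O' assume O': "openin (gtop G) O'"
  show "openin (gtop G) (src G ` O')"
  proof (subst openin_subopen, intro ballI)
    fix x assume "x \<in> src G ` O'"
    then obtain a where a: "a \<in> O'" "x = src G a" by blast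
    then have "a \<in> arrows G" using O' openin_subset by blast
    then obtain U where U: "openin (gtop G) U" "a \<in> U" "openin (unit_topology G) (src G ` U)"
        "homeomorphic_map (subtopology (gtop G) U) (subtopology (unit_topology G) (src G ` U)) (src G)"
      using src_local_homeomorphism by (auto simp: local_homeomorphism_def)
    have "openin (subtopology (gtop G) U) (O' \<inter> U)"
      using O' U by (simp add: openin_open_subtopology openin_Int)
    then have "openin (subtopology (unit_topology G) (src G ` U)) (src G ` (O' \<inter> U))"
      using U(4) homeomorphic_imp_open_map by (auto simp: open_map_def)
    then have "openin (unit_topology G) (src G ` (O' \<inter> U))" using U(3) openin_trans_full by blast
    then have "openin (gtop G) (src G ` (O' \<inter> U))"
      using openin_units openin_trans_full unfolding unit_topology_def by blast
    then show "\<exists>V. openin (gtop G) V \<and> x \<in> V \<and> V \<subseteq> src G ` O'" using a U(2) by blast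
  qed
qed

lemma inv_image: "U \<subseteq> arrows G \<Longrightarrow> ginv G ` U = {a \<in> arrows G. ginv G a \<in> U}"
  using inv_inv inv_in by (auto simp: image_iff subset_eq) metis

lemma openin_inv_image: "openin (gtop G) U \<Longrightarrow> openin (gtop G) (ginv G ` U)"
  using continuous_inv
  by (subst inv_image) (simp_all add: openin_subset openin_continuous_map_preimage)

lemma open_map_rng: "open_map (gtop G) (gtop G) (rng G)"
  unfolding open_map_def
proof (intro allI impI)
  fix O' assume O': "openin (gtop G) O'"
  have "rng G ` O' = src G ` ginv G ` O'"
    using openin_subset[OF O'] by (force simp: image_image src_inv)
  then show "openin (gtop G) (rng G ` O')"
    using open_map_src openin_inv_image[OF O'] by (auto simp: open_map_def)
qed

definition bisection :: "'a set \<Rightarrow> bool"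
  where "bisection U \<longleftrightarrow> openin (gtop G) U \<and> inj_on (src G) U \<and> inj_on (rng G) U"

lemma bisection_Int: "bisection U \<Longrightarrow> openin (gtop G) V \<Longrightarrow> bisection (U \<inter> V)"
  by (auto simp: bisection_def inj_on_def)

lemma bisection_inv: 
  assumes U: "bisection U" shows "bisection (ginv G ` U)"
proof -
  have "U \<subseteq> arrows G" using U openin_subset by (auto simp: bisection_def)
  then have "inj_on (src G) (ginv G ` U)" "inj_on (rng G) (ginv G ` U)"
    using U by (auto simp: bisection_def inj_on_def src_inv rng_inv subset_eq)
  then show ?thesis using U openin_inv_image by (simp add: bisection_def)
qed

lemma bisection_units: "bisection (unit_space G)"
  using openin_units by (auto simp: bisection_def inj_on_def src_unit rng_unit)

lemma bisection_nbhd: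
  assumes "openin (gtop G) V" "a \<in> V"
  obtains U where "bisection U" "a \<in> U" "U \<subseteq> V"
proof -
  have a: "a \<in> arrows G" using assms openin_subset by blast
  obtain U1 where U1: "openin (gtop G) U1" "a \<in> U1" "inj_on (src G) U1"
    using locally_injective_src a by blast
  obtain U2 where U2: "openin (gtop G) U2" "ginv G a \<in> U2" "inj_on (src G) U2"
    using locally_injective_src inv_in[OF a] by blast
  define U3 where "U3 = {b \<in> arrows G. ginv G b \<in> U2}"
  have U3: "openin (gtop G) U3" "a \<in> U3"
    using U2 a continuous_inv by (auto simp: U3_def openin_continuous_map_preimage)
  have "inj_on (rng G) U3"
  proof (rule inj_onI)
    fix b c assume bc: "b \<in> U3" "c \<in> U3" "rng G b = rng G c"
    then have "ginv G b = ginv G c" using U2(3) by (auto simp: U3_def inj_on_def src_inv)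
    then show "b = c" using bc inv_inv by (metis (mono_tags, lifting) U3_def mem_Collect_eq)
  qed
  then have "bisection (U1 \<inter> U3 \<inter> V)"
    using U1 U3 assms by (auto simp: bisection_def inj_on_def)
  then show ?thesis using that U1 U3 assms by blast
qed

end

context lc_etale_groupoid
begin

lemma Hausdorff_bisection:
  assumes U: "bisection U" shows "Hausdorff_space (subtopology (gtop G) U)"
proof (rule Hausdorff_space_injective_preimage[OF Hausdorff_units])
  have "continuous_map (gtop G) (unit_topology G) (src G)"
    using continuous_src by (auto simp: unit_topology_def continuous_map_in_subtopology src_in_units)
  then show "continuous_map (subtopology (gtop G) U) (unit_topology G) (src G)"
    by (rule continuous_map_from_subtopology)
  show "inj_on (src G) (topspace (subtopology (gtop G) U))"
    using U by (auto simp: bisection_def inj_on_def)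
qed

lemma Hausdorff_open_units: "Hausdorff_space (subtopology (gtop G) (unit_space G))"
  using Hausdorff_units by (simp add: unit_topology_def)

lemma bisection_extend:
  "compactly_supported (gtop G) W f \<Longrightarrow> openin (gtop G) W \<Longrightarrow> W \<subseteq> U \<Longrightarrow> bisection U \<Longrightarrow>
    compactly_supported (gtop G) U f"
  using compactly_supported_mono[of "gtop G" W f U] Hausdorff_bisection[of U]
  by (simp add: bisection_def)

text \<open>Source and range play symmetric roles in the estimates, so several lemmas below concern either of
  them, called \<open>p\<close>.\<close>

lemma
  assumes "p = src G \<or> p = rng G"
  shows anchor_continuous: "continuous_map (gtop G) (gtop G) p"
    and anchor_open: "open_map (gtop G) (gtop G) p"
    and anchor_units: "a \<in> arrows G \<Longrightarrow> p a \<in> unit_space G"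
    and anchor_inj: "bisection U \<Longrightarrow> inj_on p U"
  using assms continuous_src continuous_rng open_map_src open_map_rng src_in_units rng_in
  by (auto simp: bisection_def)

lemma anchor_image:
  assumes p: "p = src G \<or> p = rng G" and U: "bisection U"
  shows "openin (gtop G) (p ` U)" "p ` U \<subseteq> unit_space G"
proof -
  have "openin (gtop G) U" using U by (simp add: bisection_def)
  then show "openin (gtop G) (p ` U)" using anchor_open[OF p] by (simp add: open_map_def)
  show "p ` U \<subseteq> unit_space G" using anchor_units[OF p] openin_subset[OF \<open>openin (gtop G) U\<close>] by blast
qed

lemma push_compactly_supported_units:
  assumes p: "p = src G \<or> p = rng G" and U: "bisection U" and u: "compactly_supported (gtop G) U u"
  shows "compactly_supported (gtop G) (unit_space G) (push p U u)"
proof (rule bisection_extend[OF _ anchor_image[OF p U] bisection_units])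
  show "compactly_supported (gtop G) (p ` U) (push p U u)"
    using push_compactly_supported[OF _ anchor_continuous[OF p] anchor_open[OF p] anchor_inj[OF p U] u] U
    by (simp add: bisection_def)
qed

end

section \<open>Decomposition into functions on bisections\<close>

lemma (in lc_etale_groupoid) conv_algebra_bisection:
  assumes "bisection U" "compactly_supported (gtop G) U f"
  shows "f \<in> conv_algebra G"
proof -
  interpret vector_space scale_fun by (rule vector_space_scale_fun)
  show ?thesis unfolding conv_algebra_def
    using assms Hausdorff_bisection[of U]
    by (intro span_base) (auto simp: C_c_iff bisection_def)
qed

lemma conv_algebra_0: "(\<lambda>x. 0) \<in> conv_algebra G"
proof -
  interpret vector_space scale_fun by (rule vector_space_scale_fun)
  show ?thesis using span_zero by (simp add: conv_algebra_def zero_fun_def)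
qed

lemma conv_algebra_add: "f \<in> conv_algebra G \<Longrightarrow> g \<in> conv_algebra G \<Longrightarrow> (\<lambda>x. f x + g x) \<in> conv_algebra G"
proof -
  interpret vector_space scale_fun by (rule vector_space_scale_fun)
  show "f \<in> conv_algebra G \<Longrightarrow> g \<in> conv_algebra G \<Longrightarrow> ?thesis"
    using span_add[of f _ g] by (simp add: conv_algebra_def plus_fun_def)
qed

context lc_etale_groupoid
begin

text \<open>A partition of unity on the Hausdorff set \<open>U\<close>, subordinate to a finite cover of the support by
  bisections.\<close>

lemma bisection_pieces:
  assumes U: "openin (gtop G) U" and H: "Hausdorff_space (subtopology (gtop G) U)"
    and f: "compactly_supported (gtop G) U (f :: 'g \<Rightarrow> complex)"
  obtains ps where "\<And>V h. (V, h) \<in> set ps \<Longrightarrow> bisection V \<and> compactly_supported (gtop G) V h"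
    "\<And>a. f a = (\<Sum>(V, h)\<leftarrow>ps. h a)"
proof -
  obtain K where K: "compactin (gtop G) K" "K \<subseteq> U" "\<And>x. x \<notin> K \<Longrightarrow> f x = 0"
    using f by (auto simp: compactly_supported_def)
  have "\<forall>a\<in>K. \<exists>q. bisection (fst q) \<and> fst q \<subseteq> U \<and> snd q \<in> bumps (gtop G) (fst q) \<and> snd q a = 1"
  proof
    fix a assume a: "a \<in> K"
    then obtain V where V: "bisection V" "a \<in> V" "V \<subseteq> U" using bisection_nbhd[OF U] K(2) by blast
    have oV: "openin (gtop G) V" using V(1) by (simp add: bisection_def)
    then have c: "compactin (gtop G) {a}" "{a} \<subseteq> V" using V(2) openin_subset by auto
    obtain \<theta> :: "'g \<Rightarrow> real" where "compactly_supported (gtop G) V \<theta>" "\<And>y. 0 \<le> \<theta> y" "\<And>y. \<theta> y \<le> 1"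
        "\<And>y. y \<in> {a} \<Longrightarrow> \<theta> y = 1"
      using compactly_supported_bump[OF loc_compact oV Hausdorff_bisection[OF V(1)] c] by blast
    then show "\<exists>q. bisection (fst q) \<and> fst q \<subseteq> U \<and> snd q \<in> bumps (gtop G) (fst q) \<and> snd q a = 1"
      using V by (intro exI[of _ "(V, \<theta>)"]) (simp add: bumps_def)
  qed
  then obtain q where q: "\<forall>a\<in>K. bisection (fst (q a)) \<and> fst (q a) \<subseteq> U \<and>
      snd (q a) \<in> bumps (gtop G) (fst (q a)) \<and> snd (q a) a = 1"
    using bchoice[of K "\<lambda>a q. bisection (fst q) \<and> fst q \<subseteq> U \<and> snd q \<in> bumps (gtop G) (fst q) \<and> snd q a = 1"]
    by blast
  define V \<kappa> where "V a = fst (q a)" and "\<kappa> a = snd (q a)" for a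
  have V: "bisection (V a)" "V a \<subseteq> U" and \<kappa>: "\<kappa> a \<in> bumps (gtop G) (V a)" "\<kappa> a a = 1" if "a \<in> K" for a
    using q that by (auto simp: V_def \<kappa>_def)
  have cs: "compactly_supported (gtop G) U (\<kappa> a)" if "a \<in> K" for a
    using compactly_supported_mono[OF _ V(2)[OF that] _ U H, of "\<kappa> a"] \<kappa>(1)[OF that] V(1)[OF that]
    by (simp add: bumps_def bisection_def)
  define N where "N a = {b \<in> U. \<kappa> a b \<in> {1/2<..}}" for a
  have N_open: "openin (gtop G) (N a)" if "a \<in> K" for a
  proof -
    have "openin (subtopology (gtop G) U) {b \<in> topspace (subtopology (gtop G) U). \<kappa> a b \<in> {1/2<..}}"
      using cs[OF that] unfolding compactly_supported_def by (intro openin_continuous_map_preimage) auto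
    then show ?thesis
      using U openin_subset[OF U] by (simp add: N_def openin_open_subtopology Int_absorb1)
  qed
  have "K \<subseteq> \<Union>(N ` K)" using \<kappa>(2) K(2) by (force simp: N_def)
  then have "\<exists>\<F>. finite \<F> \<and> \<F> \<subseteq> N ` K \<and> K \<subseteq> \<Union>\<F>"
    using K(1) N_open unfolding compactin_def by (auto dest!: spec[of _ "N ` K"])
  then obtain F where F: "finite F" "F \<subseteq> K" "K \<subseteq> \<Union>(N ` F)"
    by (metis finite_subset_image)
  obtain xs where xs: "set xs = F" using finite_list[OF F(1)] by blast
  define \<sigma> where "\<sigma> b = (\<Sum>a\<leftarrow>xs. \<kappa> a b)" for b
  have cs_\<sigma>: "compactly_supported (gtop G) U \<sigma>"
    unfolding \<sigma>_def using cs F(2) xs by (intro compactly_supported_sum_list) auto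
  have \<sigma>_ge: "1/2 \<le> \<sigma> b" if b: "b \<in> K" for b
  proof -
    obtain a where a: "a \<in> F" "b \<in> N a" using F(3) b by blast
    have "\<kappa> a b \<le> \<sigma> b" unfolding \<sigma>_def
      by (rule member_le_sum_list) (use a xs F(2) \<kappa>(1) in \<open>auto simp: bumps_def\<close>)
    then show ?thesis using a by (simp add: N_def)
  qed
  \<comment> \<open>The sum of the bumps is at least 1/2 on the support, so the maximum changes
    nothing there and makes the quotient continuous everywhere.\<close>
  define g where "g b = f b / of_real (max (\<sigma> b) (1/2))" for b
  have max_nz: "max s (1/2) \<noteq> 0" for s :: real by (simp add: max_def)
  have cs_g: "compactly_supported (gtop G) U g"
    unfolding g_def
    by (rule compactly_supported_comp2[OF f cs_\<sigma>, where \<phi> = "\<lambda>y s. y / of_real (max s (1/2))"])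
      (auto intro!: continuous_intros simp: max_nz)
  show ?thesis
  proof
    show "bisection W \<and> compactly_supported (gtop G) W h"
      if "(W, h) \<in> set (map (\<lambda>a. (V a, \<lambda>b. of_real (\<kappa> a b) * g b)) xs)" for W h
      using that V \<kappa>(1) F(2) xs compactly_supported_mult_restrict[OF cs_g, of _ "\<kappa> _"]
      by (auto simp: bumps_def)
    show "f b = (\<Sum>(W, h)\<leftarrow>map (\<lambda>a. (V a, \<lambda>b. of_real (\<kappa> a b) * g b)) xs. h b)" for b
    proof -
      have "(\<Sum>(W, h)\<leftarrow>map (\<lambda>a. (V a, \<lambda>b. of_real (\<kappa> a b) * g b)) xs. h b) = of_real (\<sigma> b) * g b"
        unfolding \<sigma>_def by (induction xs) (auto simp: algebra_simps)
      also have "\<dots> = f b"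
        using \<sigma>_ge[of b] K(3)[of b] by (cases "b \<in> K") (auto simp: g_def)
      finally show ?thesis by simp
    qed
  qed
qed

lemma conv_algebra_decomposition:
  assumes "f \<in> conv_algebra G"
  obtains ps where "\<And>V h. (V, h) \<in> set ps \<Longrightarrow> bisection V \<and> compactly_supported (gtop G) V h"
    "\<And>a. f a = (\<Sum>(V, h)\<leftarrow>ps. h a)"
proof -
  interpret vector_space scale_fun by (rule vector_space_scale_fun)
  let ?P = "\<lambda>(f :: 'g \<Rightarrow> complex) ps. (\<forall>(V, h)\<in>set ps. bisection V \<and> compactly_supported (gtop G) V h) \<and>
    (\<forall>a. f a = (\<Sum>(V, h)\<leftarrow>ps. h a))"
  let ?D = "{f. \<exists>ps. ?P f ps}"
  have "subspace ?D"
  proof (rule subspaceI)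
    show "0 \<in> ?D" by (auto intro!: exI[of _ "[]"])
    fix f g c assume "f \<in> ?D"
    then obtain ps where ps: "?P f ps" by blast
    show "f + g \<in> ?D" if "g \<in> ?D"
    proof -
      obtain qs where "?P g qs" using \<open>g \<in> ?D\<close> by blast
      then have "?P (f + g) (ps @ qs)" using ps by auto
      then show ?thesis by blast
    qed
    have "compactly_supported (gtop G) V (\<lambda>a. c * h a)" if "(V, h) \<in> set ps" for V h
      by (rule compactly_supported_comp[where \<phi> = "\<lambda>z. c * z"])
        (use ps that in \<open>auto intro!: continuous_intros\<close>)
    moreover have "c * (\<Sum>(V, h)\<leftarrow>ps. h a) = (\<Sum>(V, h)\<leftarrow>map (\<lambda>(V, h). (V, \<lambda>a. c * h a)) ps. h a)" for a
      by (induction ps) (auto simp: algebra_simps)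
    ultimately have "?P (scale_fun c f) (map (\<lambda>(V, h). (V, \<lambda>a. c * h a)) ps)"
      using ps by (auto simp: scale_fun_def)
    then show "scale_fun c f \<in> ?D" by blast
  qed
  moreover have "C_c (gtop G) U \<subseteq> ?D"
    if U: "openin (gtop G) U" "Hausdorff_space (subtopology (gtop G) U)" for U
  proof
    fix f assume "f \<in> C_c (gtop G) U"
    then obtain ps where "\<And>V h. (V, h) \<in> set ps \<Longrightarrow> bisection V \<and> compactly_supported (gtop G) V h"
      "\<And>a. f a = (\<Sum>(V, h)\<leftarrow>ps. h a)"
      using bisection_pieces[OF U, of f] by (auto simp: C_c_iff)
    then have "?P f ps" by auto
    then show "f \<in> ?D" by blast
  qed
  then have "(\<Union>U \<in> {U. openin (gtop G) U \<and> Hausdorff_space (subtopology (gtop G) U)}. C_c (gtop G) U) \<subseteq> ?D"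
    by blast
  ultimately have "conv_algebra G \<subseteq> ?D" unfolding conv_algebra_def by (rule span_minimal[rotated])
  then obtain ps where "?P f ps" using assms by blast
  then show ?thesis using that[of ps] by auto
qed

text \<open>The heart of the argument. In \<open>f = f\<^sub>1 + \<dots> + f\<^sub>n\<close> there can be cancellation where the bisections
  overlap, and then \<open>\<Sum>|f\<^sub>i|\<close> is larger than \<open>|f|\<close>. If indicator functions were available, all values on
  the first bisection \<open>U\<close> could be collected into a single function on \<open>U\<close>, leaving functions that vanish
  on \<open>U\<close>, and so on; the resulting pieces have disjoint supports. The indicator of \<open>U \<inter> V\<close> is
  replaced here by a bump \<open>\<psi>\<close> on \<open>U \<inter> V\<close>: the part \<open>\<psi> f\<^sub>i\<close> is moved to \<open>U\<close> and \<open>(1 - \<psi>) f\<^sub>i\<close> stays. The price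
  is paid at the points of \<open>U \<inter> V\<close> where \<open>\<psi> < 1\<close>. The predicate \<open>good\<close> is a parameter because what makes
  this price small depends on the functionals against which the estimate is integrated.\<close>

lemma almost_disjoint_pieces:
  fixes good :: "'g set \<Rightarrow> ('g \<Rightarrow> real) \<Rightarrow> bool" and B :: real
  assumes good: "\<And>W. bisection W \<Longrightarrow> \<exists>\<psi>\<in>bumps (gtop G) W. good W \<psi>"
    and ps: "\<And>U f. (U, f) \<in> set ps \<Longrightarrow>
      bisection U \<and> compactly_supported (gtop G) U f \<and> (\<forall>a. cmod (f a) \<le> B)"
  obtains hs ws where
    "\<And>U h. (U, h) \<in> set hs \<Longrightarrow> bisection U \<and> compactly_supported (gtop G) U h"
    "\<And>W \<psi>. (W, \<psi>) \<in> set ws \<Longrightarrow> bisection W \<and> \<psi> \<in> bumps (gtop G) W \<and> good W \<psi>"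
    "length ws \<le> length ps * length ps"
    "\<And>a. (\<Sum>(U, h)\<leftarrow>hs. h a) = (\<Sum>(U, f)\<leftarrow>ps. f a)"
    "\<And>a. (\<Sum>(U, h)\<leftarrow>hs. cmod (h a)) \<le>
      cmod (\<Sum>(U, f)\<leftarrow>ps. f a) + 2 * B * (\<Sum>(W, \<psi>)\<leftarrow>ws. indicator W a - \<psi> a)"
  using ps
proof (induction "length ps" arbitrary: ps thesis)
  case 0
  show ?case by (rule "0.prems"(1)[of "[]" "[]"]) (use 0 in auto)
next
  case (Suc n pps)
  obtain U f ps where pps: "pps = (U, f) # ps" using Suc.hyps(2) by (metis length_Suc_conv prod.exhaust)
  have U: "bisection U" and oU: "openin (gtop G) U" and f: "compactly_supported (gtop G) U f" 
    using Suc.prems(2)[of U f] by (auto simp: pps bisection_def)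
  have P: "bisection V" "openin (gtop G) V" "compactly_supported (gtop G) V g" "cmod (g a) \<le> B"
    if "(V, g) \<in> set ps" for V g a using Suc.prems(2)[of V g] that by (auto simp: pps bisection_def)
  have "\<exists>\<psi>. bisection V \<longrightarrow> \<psi> \<in> bumps (gtop G) (U \<inter> V) \<and> good (U \<inter> V) \<psi>" for V
    using good[of "U \<inter> V"] bisection_Int[OF U, of V] by (auto simp: bisection_def)
  then obtain \<Psi> where \<Psi>: "\<And>V. bisection V \<Longrightarrow> \<Psi> V \<in> bumps (gtop G) (U \<inter> V)"
      "\<And>V. bisection V \<Longrightarrow> good (U \<inter> V) (\<Psi> V)" by metis
  have cs\<Psi>: "compactly_supported (gtop G) (U \<inter> V) (\<Psi> V)" and \<Psi>01: "0 \<le> \<Psi> V a" "\<Psi> V a \<le> 1"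
    and \<Psi>_out: "a \<notin> U \<inter> V \<Longrightarrow> \<Psi> V a = 0" if "bisection V" for V a
    using \<Psi>(1)[OF that] compactly_supported_outside[of _ "U \<inter> V" "\<Psi> V" a] by (auto simp: bumps_def)
  define ps' where "ps' = map (\<lambda>(V, g). (V, \<lambda>a. (1 - \<Psi> V a) * g a)) ps"
  define ws\<^sub>0 where "ws\<^sub>0 = map (\<lambda>(V, g). (U \<inter> V, \<Psi> V)) ps"
  \<comment> \<open>The functions moved to the first bisection, and the sum of what remains.\<close>
  define m where "m a = (\<Sum>(V, g)\<leftarrow>ps. of_real (\<Psi> V a) * g a)" for a
  define R where "R a = (\<Sum>(V, g)\<leftarrow>ps'. g a)" for a
  have ps'_bound: "bisection V \<and> compactly_supported (gtop G) V g \<and> (\<forall>a. cmod (g a) \<le> B)"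
    if Vg': "(V, g) \<in> set ps'" for V g
  proof -
    obtain g' :: "'g \<Rightarrow> complex" where g': "(V, g') \<in> set ps" "g = (\<lambda>a. (1 - \<Psi> V a) * g' a)"
      using Vg' unfolding ps'_def by force
    note V = P[OF g'(1)]
    have "compactly_supported (gtop G) V (\<Psi> V)"
      using cs\<Psi>[OF V(1)] V oU bisection_extend[of "U \<inter> V" "\<Psi> V" V] by (simp add: openin_Int)
    then have "compactly_supported (gtop G) V g"
      unfolding g'(2) by (rule compactly_supported_comp2[OF V(3), where \<phi> = "\<lambda>y t. of_real (1 - t) * y"])
        (auto intro!: continuous_intros)
    moreover have "cmod (g a) \<le> B" for a
    proof -
      have "cmod (g a) = (1 - \<Psi> V a) * cmod (g' a)"
        using \<Psi>01[OF V(1), of a] unfolding g'(2) norm_mult norm_of_real by simp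
      also have "\<dots> \<le> 1 * cmod (g' a)" using \<Psi>01[OF V(1), of a] by (intro mult_right_mono) auto
      finally show ?thesis using V(4)[of a] by simp
    qed
    ultimately show ?thesis using V(1) by blast
  qed
  have n: "n = length ps'" using Suc.hyps(2) by (simp add: pps ps'_def)
  obtain hs ws where IH:
    "\<And>U h. (U, h) \<in> set hs \<Longrightarrow> bisection U \<and> compactly_supported (gtop G) U h"
    "\<And>W \<psi>. (W, \<psi>) \<in> set ws \<Longrightarrow> bisection W \<and> \<psi> \<in> bumps (gtop G) W \<and> good W \<psi>"
    "length ws \<le> length ps' * length ps'"
    "\<And>a. (\<Sum>(U, h)\<leftarrow>hs. h a) = R a"
    "\<And>a. (\<Sum>(U, h)\<leftarrow>hs. cmod (h a)) \<le> cmod (R a) + 2 * B * (\<Sum>(W, \<psi>)\<leftarrow>ws. indicator W a - \<psi> a)"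
    unfolding R_def by (rule Suc.hyps(1)[OF n _ ps'_bound]) blast+
  define h\<^sub>0 where "h\<^sub>0 a = f a + m a" for a
  have mR: "m a + R a = (\<Sum>(V, g)\<leftarrow>ps. g a)" for a
    unfolding m_def R_def ps'_def by (induction ps) (auto simp: algebra_simps)
  have cs_m: "compactly_supported (gtop G) U m"
    unfolding m_def
  proof (rule compactly_supported_sum_list)
    fix i assume i: "i \<in> set ps"
    obtain V g where Vg: "i = (V, g)" by fastforce
    note V = P[OF i[unfolded Vg]]
    have "compactly_supported (gtop G) (U \<inter> V) (\<lambda>a. of_real (\<Psi> V a) * g a)"
      by (rule compactly_supported_mult_restrict[OF V(3) cs\<Psi>[OF V(1)]]) simp
    then have "compactly_supported (gtop G) U (\<lambda>a. of_real (\<Psi> V a) * g a)"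
      using V(2) oU U by (intro bisection_extend[of "U \<inter> V" _ U]) auto
    then show "compactly_supported (gtop G) U (\<lambda>a. case i of (V, g) \<Rightarrow> of_real (\<Psi> V a) * g a)"
      by (simp add: Vg)
  qed
  have step: "cmod (h\<^sub>0 a) + cmod (R a) \<le>
      cmod (f a + m a + R a) + 2 * B * (\<Sum>(W, \<psi>)\<leftarrow>ws\<^sub>0. indicator W a - \<psi> a)" for a
  proof (cases "a \<in> U")
    case True
    \<comment> \<open>On the first bisection the remainder is small, since it lives where the bumps are below 1.\<close>
    have "cmod (R a) \<le> B * (\<Sum>(W, \<psi>)\<leftarrow>ws\<^sub>0. indicator W a - \<psi> a)"
      unfolding R_def ps'_def ws\<^sub>0_def using P \<Psi>01 \<Psi>_out
    proof (induction ps)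
      case (Cons q ps)
      obtain V g where q: "q = (V, g)" by fastforce
      have V: "bisection V" "compactly_supported (gtop G) V g" "cmod (g a) \<le> B"
        using Cons.prems(1,3,4)[of V g] by (auto simp: q)
      have "cmod ((1 - \<Psi> V a) * g a) \<le> B * (indicator (U \<inter> V) a - \<Psi> V a)"
      proof (cases "a \<in> V")
        case aV: True
        have "cmod ((1 - \<Psi> V a) * g a) = (1 - \<Psi> V a) * cmod (g a)"
          using \<Psi>01[OF V(1), of a] unfolding norm_mult norm_of_real by simp
        also have "\<dots> \<le> (1 - \<Psi> V a) * B" using \<Psi>01[OF V(1), of a] V(3) by (intro mult_left_mono) auto
        finally show ?thesis using True aV by (simp add: mult.commute)
      next
        case False
        then show ?thesis using compactly_supported_outside[OF V(2) False] \<Psi>_out[OF V(1), of a] by simp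
      qed
      then show ?case using Cons.IH Cons.prems
        by (simp add: q) (smt (verit) distrib_left norm_triangle_ineq)
    qed simp
    moreover have "cmod (h\<^sub>0 a) \<le> cmod (f a + m a + R a) + cmod (R a)"
      unfolding h\<^sub>0_def by (metis add_diff_cancel_right' norm_triangle_ineq4)
    ultimately show ?thesis by simp
  next
    case False
    have "(\<Sum>(W, \<psi>)\<leftarrow>ws\<^sub>0. indicator W a - \<psi> a) = (\<Sum>(W, \<psi>)\<leftarrow>ws\<^sub>0. 0)"
      using False \<Psi>_out P(1) unfolding ws\<^sub>0_def
      by (intro arg_cong[of _ _ sum_list] map_cong) (auto simp: indicator_def)
    then have "(\<Sum>(W, \<psi>)\<leftarrow>ws\<^sub>0. indicator W a - \<psi> a) = 0" by (simp add: case_prod_unfold)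
    moreover have "f a = 0" "m a = 0"
      using compactly_supported_outside[OF f False] compactly_supported_outside[OF cs_m False] by auto
    ultimately show ?thesis by (simp add: h\<^sub>0_def)
  qed
  show ?case
  proof (rule Suc.prems(1)[of "(U, h\<^sub>0) # hs" "ws\<^sub>0 @ ws"])
    have "compactly_supported (gtop G) U h\<^sub>0"
      unfolding h\<^sub>0_def by (intro compactly_supported_add f cs_m)
    then show "bisection W \<and> compactly_supported (gtop G) W h" if "(W, h) \<in> set ((U, h\<^sub>0) # hs)" for W h
      using that IH(1) U by auto
    show "bisection W \<and> \<psi> \<in> bumps (gtop G) W \<and> good W \<psi>" if "(W, \<psi>) \<in> set (ws\<^sub>0 @ ws)" for W \<psi>
      using that IH(2) \<Psi> P bisection_Int[OF U] by (auto simp: ws\<^sub>0_def)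
    show "length (ws\<^sub>0 @ ws) \<le> length pps * length pps"
      using IH(3) by (simp add: ws\<^sub>0_def ps'_def pps)
    show "(\<Sum>(U, h)\<leftarrow>(U, h\<^sub>0) # hs. h a) = (\<Sum>(U, f)\<leftarrow>pps. f a)" for a
      using IH(4)[of a] mR[of a] by (simp add: h\<^sub>0_def pps)
    show "(\<Sum>(U, h)\<leftarrow>(U, h\<^sub>0) # hs. cmod (h a)) \<le>
        cmod (\<Sum>(U, f)\<leftarrow>pps. f a) + 2 * B * (\<Sum>(W, \<psi>)\<leftarrow>ws\<^sub>0 @ ws. indicator W a - \<psi> a)" for a
    proof -
      have "f a + m a + R a = (\<Sum>(U, f)\<leftarrow>pps. f a)" using mR[of a] by (simp add: pps)
      then show ?thesis using IH(5)[of a] step[of a] by (simp add: algebra_simps)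
    qed
  qed
qed

section \<open>Integration over fibres\<close>

lemma fibre_sum_le_I_norm:
  assumes p: "p = src G \<or> p = rng G" and c: "I_norm G f \<le> ennreal c" "0 \<le> c" and x: "x \<in> unit_space G"
    and F: "finite F" "F \<subseteq> arrows G" "\<And>a. a \<in> F \<Longrightarrow> p a = x"
  shows "(\<Sum>a\<in>F. cmod (f a)) \<le> c"
proof -
  have "ennreal (\<Sum>a\<in>F. cmod (f a)) = (\<Sum>a\<in>F. ennreal (cmod (f a)))" by simp
  also have "\<dots> \<le> (\<Sum>\<^sub>\<infinity>a\<in>{a \<in> arrows G. p a = x}. ennreal (cmod (f a)))"
    using F by (subst nonneg_infsum_complete) (auto intro!: SUP_upper)
  also have "\<dots> \<le> I_norm G f"
    unfolding I_norm_def using p x by (intro SUP_upper2[OF x]) auto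
  finally have "ennreal (\<Sum>a\<in>F. cmod (f a)) \<le> ennreal c" using c(1) by (rule order_trans)
  then show ?thesis using c(2) by simp
qed

text \<open>Summing the bound of \<open>almost_disjoint_pieces\<close> over a fibre of \<open>p\<close> gives a pointwise bound on the unit
  space: the values of \<open>f\<close> contribute at most the \<open>I\<close>-norm, and each error term contributes the
  difference between the indicator of the open set \<open>p(W)\<close> and the push-forward of \<open>\<psi>\<close>. Integrating
  this with \<open>le_mass_sum\<close> leaves an error of \<open>b \<epsilon>\<close> for each \<open>W\<close>.\<close>

lemma positive_functional_estimate:
  fixes L :: "('g \<Rightarrow> real) \<Rightarrow> real" and \<epsilon> :: real
  assumes L: "positive_functional (gtop G) (unit_space G) L m"
    and p: "p = src G \<or> p = rng G" and c: "I_norm G f \<le> ennreal c" "0 \<le> c" and b: "0 \<le> b"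
    and hs: "\<And>U h. (U, h) \<in> set hs \<Longrightarrow> bisection U \<and> compactly_supported (gtop G) U h"
    and ws: "\<And>W \<psi>. (W, \<psi>) \<in> set ws \<Longrightarrow> bisection W \<and> \<psi> \<in> bumps (gtop G) W \<and>
      positive_functional.mass (gtop G) L (p ` W) - \<epsilon> \<le> L (push p W \<psi>)"
    and le: "\<And>a. (\<Sum>(U, h)\<leftarrow>hs. cmod (h a)) \<le> cmod (f a) + b * (\<Sum>(W, \<psi>)\<leftarrow>ws. indicator W a - \<psi> a)"
  shows "(\<Sum>(U, h)\<leftarrow>hs. L (push p U (\<lambda>a. cmod (h a)))) \<le> c * m + b * (length ws * \<epsilon>)"
proof -
  interpret L: positive_functional "gtop G" "unit_space G" L m by (rule L)
  define g where "g x = (\<Sum>(U, h)\<leftarrow>hs. push p U (\<lambda>a. cmod (h a)) x)" for x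
  define k where "k x = (\<Sum>(W, \<psi>)\<leftarrow>ws. push p W \<psi> x)" for x
  have cs_g1: "compactly_supported (gtop G) (unit_space G) (case i of (U, h) \<Rightarrow> push p U (\<lambda>a. cmod (h a)))"
    if "i \<in> set hs" for i
  proof -
    obtain U h where i: "i = (U, h)" by fastforce
    then have U: "bisection U" "compactly_supported (gtop G) U h" using hs[of U h] that by auto
    have "compactly_supported (gtop G) U (\<lambda>a. cmod (h a))"
      by (rule compactly_supported_comp[OF U(2)]) (auto intro!: continuous_intros)
    then show ?thesis using push_compactly_supported_units[OF p U(1)] by (simp add: i)
  qed
  have cs_k1: "compactly_supported (gtop G) (unit_space G) (case i of (W, \<psi>) \<Rightarrow> push p W \<psi>)"
    if "i \<in> set ws" for i
    using ws[of "fst i" "snd i"] that push_compactly_supported_units[OF p, of "fst i" "snd i"]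
    by (simp add: bumps_def case_prod_unfold)
  have cs_g: "compactly_supported (gtop G) (unit_space G) g"
    unfolding g_def case_prod_unfold using cs_g1 by (intro compactly_supported_sum_list) (auto simp: case_prod_unfold)
  have cs_k: "compactly_supported (gtop G) (unit_space G) k"
    unfolding k_def case_prod_unfold using cs_k1 by (intro compactly_supported_sum_list) (auto simp: case_prod_unfold)
  have Lg: "L g = (\<Sum>(U, h)\<leftarrow>hs. L (push p U (\<lambda>a. cmod (h a))))"
    using L.sum_list[where xs = hs and F = "\<lambda>(U, h). push p U (\<lambda>a. cmod (h a))", OF cs_g1] by (simp add: g_def[abs_def] case_prod_unfold)
  have Lk: "L k = (\<Sum>(W, \<psi>)\<leftarrow>ws. L (push p W \<psi>))"
    using L.sum_list[where xs = ws and F = "\<lambda>(W, \<psi>). push p W \<psi>", OF cs_k1] by (simp add: k_def[abs_def] case_prod_unfold)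
  have "L (\<lambda>x. g x + b * k x) \<le> c * m + b * (\<Sum>V\<leftarrow>map (\<lambda>(W, \<psi>). p ` W) ws. L.mass V)"
  proof (rule L.le_mass_sum[OF _ _ b c(2)])
    show "compactly_supported (gtop G) (unit_space G) (\<lambda>x. g x + b * k x)"
      by (intro compactly_supported_add cs_g L.compactly_supported_scale cs_k)
    show "openin (gtop G) V \<and> V \<subseteq> unit_space G" if V: "V \<in> set (map (\<lambda>(W, \<psi>). p ` W) ws)" for V
    proof -
      obtain W \<psi> where W: "(W, \<psi>) \<in> set ws" "V = p ` W" using V by auto
      show ?thesis using anchor_image[OF p, of W] ws[OF W(1)] unfolding W(2) by blast
    qed
    fix x assume x: "x \<in> unit_space G"
    \<comment> \<open>A single finite set of arrows that carries the fibres over \<open>x\<close> of all push-forwards involved.\<close>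
    define F where "F = {a. p a = x \<and> (\<exists>U\<in>fst ` set (hs) \<union> fst ` set ws. a \<in> U)}"
    have bis: "bisection U" if "U \<in> fst ` set hs \<union> fst ` set ws" for U using that hs ws by force
    have "finite {a \<in> U. p a = x}" if "U \<in> fst ` set hs \<union> fst ` set ws" for U
    proof (rule finite_subset)
      show "{a \<in> U. p a = x} \<subseteq> {the_inv_into U p x}"
        using anchor_inj[OF p bis[OF that]] by (auto simp: the_inv_into_f_f)
    qed simp
    moreover have "F = (\<Union>U\<in>fst ` set hs \<union> fst ` set ws. {a \<in> U. p a = x})" by (auto simp: F_def)
    ultimately have F: "finite F" by simp
    have F_arr: "F \<subseteq> arrows G"
      using bis openin_subset unfolding F_def bisection_def by blast
    have push: "push p U u x = (\<Sum>a\<in>F. u a)"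
      if "U \<in> fst ` set hs \<union> fst ` set ws" "\<And>a. a \<notin> U \<Longrightarrow> u a = 0" for U and u :: "'g \<Rightarrow> real"
      by (rule push_eq_sum[OF anchor_inj[OF p bis[OF that(1)]] F]) (use that in \<open>auto simp: F_def\<close>)
    have "g x = (\<Sum>(U, h)\<leftarrow>hs. \<Sum>a\<in>F. cmod (h a))"
      unfolding g_def
    proof (intro arg_cong[of _ _ sum_list] map_cong refl)
      fix i assume i: "i \<in> set hs"
      obtain U h where Uh: "i = (U, h)" by fastforce
      have "push p U (\<lambda>a. cmod (h a)) x = (\<Sum>a\<in>F. cmod (h a))"
        by (rule push) (use i Uh hs[of U h] compactly_supported_outside[of _ U h] in force)+
      then show "(case i of (U, h) \<Rightarrow> push p U (\<lambda>a. cmod (h a)) x) = (case i of (U, h) \<Rightarrow> \<Sum>a\<in>F. cmod (h a))"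
        by (simp add: Uh)
    qed
    also have "\<dots> = (\<Sum>a\<in>F. \<Sum>(U, h)\<leftarrow>hs. cmod (h a))"
      by (induction hs) (auto simp: sum.distrib)
    also have "\<dots> \<le> (\<Sum>a\<in>F. cmod (f a) + b * (\<Sum>(W, \<psi>)\<leftarrow>ws. indicator W a - \<psi> a))"
      by (intro sum_mono le)
    also have "\<dots> = (\<Sum>a\<in>F. cmod (f a)) + b * (\<Sum>a\<in>F. \<Sum>(W, \<psi>)\<leftarrow>ws. indicator W a - \<psi> a)"
      by (simp add: sum.distrib sum_distrib_left)
    also have "(\<Sum>a\<in>F. \<Sum>(W, \<psi>)\<leftarrow>ws. indicator W a - \<psi> a) =
        (\<Sum>(W, \<psi>)\<leftarrow>ws. (\<Sum>a\<in>F. indicator W a) - (\<Sum>a\<in>F. \<psi> a))"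
      by (induction ws) (auto simp: sum.distrib sum_subtractf)
    also have "\<dots> = (\<Sum>(W, \<psi>)\<leftarrow>ws. indicator (p ` W) x - push p W \<psi> x)"
    proof (intro arg_cong[of _ _ sum_list] map_cong refl)
      fix i assume i: "i \<in> set ws"
      obtain W \<psi> where W\<psi>: "i = (W, \<psi>)" by fastforce
      have W: "W \<in> fst ` set hs \<union> fst ` set ws" using i W\<psi> by force
      have "push p W \<psi> x = (\<Sum>a\<in>F. \<psi> a)"
        by (rule push[OF W]) (use i W\<psi> ws[of W \<psi>] compactly_supported_outside[of "gtop G" W \<psi>] in \<open>simp add: bumps_def\<close>)
      moreover have "push p W (indicator W) x = (\<Sum>a\<in>F. indicator W a :: real)"
        by (rule push[OF W]) simp
      moreover have "push p W (indicator W) x = (indicator (p ` W) x :: real)"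
        using push_eq[OF anchor_inj[OF p bis[OF W]], where u = "indicator W"]
        by (cases "x \<in> p ` W") (auto simp: push_outside)
      ultimately show "(case i of (W, \<psi>) \<Rightarrow> (\<Sum>a\<in>F. indicator W a) - (\<Sum>a\<in>F. \<psi> a)) =
          (case i of (W, \<psi>) \<Rightarrow> indicator (p ` W) x - push p W \<psi> x)" by (simp add: W\<psi>)
    qed
    also have "\<dots> = (\<Sum>V\<leftarrow>map (\<lambda>(W, \<psi>). p ` W) ws. indicator V x) - k x"
      unfolding k_def by (induction ws) auto
    finally have "g x \<le> (\<Sum>a\<in>F. cmod (f a)) +
      b * ((\<Sum>V\<leftarrow>map (\<lambda>(W, \<psi>). p ` W) ws. indicator V x) - k x)" .
    moreover have "(\<Sum>a\<in>F. cmod (f a)) \<le> c"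
      by (rule fibre_sum_le_I_norm[OF p c x F F_arr]) (simp add: F_def)
    ultimately show "g x + b * k x \<le> c + b * (\<Sum>V\<leftarrow>map (\<lambda>(W, \<psi>). p ` W) ws. indicator V x)"
      by (simp add: algebra_simps)
  qed
  moreover have "L (\<lambda>x. g x + b * k x) = L g + b * L k"
    by (simp only: L.add[OF cs_g L.compactly_supported_scale[OF cs_k]] L.scale[OF cs_k])
  moreover have "(\<Sum>V\<leftarrow>map (\<lambda>(W, \<psi>). p ` W) ws. L.mass V) \<le> (\<Sum>(W, \<psi>)\<leftarrow>ws. L (push p W \<psi>) + \<epsilon>)"
    unfolding map_map o_def using ws by (intro sum_list_mono) force
  moreover have "(\<Sum>(W, \<psi>)\<leftarrow>ws. L (push p W \<psi>) + \<epsilon>) = L k + length ws * \<epsilon>"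
    unfolding Lk by (induction ws) (auto simp: algebra_simps)
  ultimately have "L g + b * L k \<le> c * m + b * (L k + length ws * \<epsilon>)"
    using b by (smt (verit) mult_left_mono)
  then show ?thesis by (simp add: Lg algebra_simps)
qed

text \<open>Bumps on \<open>W\<close> are directed, so one of them nearly exhausts the mass of the source and, for another
  functional, of the range of \<open>W\<close> at the same time.\<close>

lemma near_maximal_bump:
  fixes \<epsilon> :: real
  assumes L: "positive_functional (gtop G) (unit_space G) L m"
    and L': "positive_functional (gtop G) (unit_space G) L' m'"
    and W: "bisection W" and \<epsilon>: "0 < \<epsilon>"
  shows "\<exists>\<psi>\<in>bumps (gtop G) W.
    positive_functional.mass (gtop G) L (src G ` W) - \<epsilon> \<le> L (push (src G) W \<psi>) \<and>
    positive_functional.mass (gtop G) L' (rng G ` W) - \<epsilon> \<le> L' (push (rng G) W \<psi>)"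
proof -
  interpret L: positive_functional "gtop G" "unit_space G" L m by (rule L)
  interpret L': positive_functional "gtop G" "unit_space G" L' m' by (rule L')
  have oW: "openin (gtop G) W" using W by (simp add: bisection_def)
  have s: "src G = src G \<or> src G = rng G" and r: "rng G = src G \<or> rng G = rng G" by auto
  obtain \<theta> where \<theta>: "\<theta> \<in> bumps (gtop G) (src G ` W)" "L.mass (src G ` W) - \<epsilon> < L \<theta>"
    using L.mass_approx[OF \<epsilon>] by blast
  obtain \<psi> where \<psi>: "\<psi> \<in> bumps (gtop G) W" "push (src G) W \<psi> = \<theta>"
    using push_bumps_surj[OF oW anchor_continuous[OF s] anchor_open[OF s] anchor_inj[OF s W] \<theta>(1)] by blast
  obtain \<theta>' where \<theta>': "\<theta>' \<in> bumps (gtop G) (rng G ` W)" "L'.mass (rng G ` W) - \<epsilon> < L' \<theta>'"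
    using L'.mass_approx[OF \<epsilon>] by blast
  obtain \<psi>' where \<psi>': "\<psi>' \<in> bumps (gtop G) W" "push (rng G) W \<psi>' = \<theta>'"
    using push_bumps_surj[OF oW anchor_continuous[OF r] anchor_open[OF r] anchor_inj[OF r W] \<theta>'(1)] by blast
  obtain \<omega> where \<omega>: "\<omega> \<in> bumps (gtop G) W" "\<And>x. \<psi> x \<le> \<omega> x" "\<And>x. \<psi>' x \<le> \<omega> x"
    using bumps_upper_bound[of "{\<psi>, \<psi>'}" "\<lambda>\<phi>. \<phi>" "gtop G" W] \<psi>(1) \<psi>'(1) by auto
  have cs: "compactly_supported (gtop G) (unit_space G) (push p W \<phi>)"
    if "p = src G \<or> p = rng G" "\<phi> \<in> bumps (gtop G) W" for p \<phi>
    using push_compactly_supported_units[OF that(1) W, of \<phi>] that(2) by (simp add: bumps_def)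
  have "L (push (src G) W \<psi>) \<le> L (push (src G) W \<omega>)"
    by (intro L.mono cs s \<psi>(1) \<omega>(1)) (simp add: push_def \<omega>)
  moreover have "L' (push (rng G) W \<psi>') \<le> L' (push (rng G) W \<omega>)"
    by (intro L'.mono cs r \<psi>'(1) \<omega>(1)) (simp add: push_def \<omega>)
  ultimately show ?thesis using \<theta>(2) \<theta>'(2) \<psi>(2) \<psi>'(2) \<omega>(1) by (intro bexI[of _ \<omega>]) auto
qed

end

section \<open>Inner products\<close>

lemma cinner_add_right:
  fixes x y z :: "'h::complex_hilbert"
  shows "cinner x (y + z) = cinner x y + cinner x z"
  by (metis cinner_add_left cinner_commute complex_cnj_add)

lemma cinner_minus_left: "cinner (- x) y = - cinner x (y :: 'h::complex_hilbert)"
  using cinner_scaleC_left[of "-1" x y] scaleC_of_real[of "-1" x] by simp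

lemma cinner_minus_right: "cinner x (- y) = - cinner x (y :: 'h::complex_hilbert)"
  by (metis cinner_commute cinner_minus_left complex_cnj_minus)

lemma Re_cinner_commute: "Re (cinner x y) = Re (cinner y (x :: 'h::complex_hilbert))"
  by (subst cinner_commute) simp

lemma Re_cinner_le: "2 * Re (cinner x y) \<le> (norm x)\<^sup>2 + (norm (y :: 'h::complex_hilbert))\<^sup>2"
proof -
  have "Re (cinner (x + - y) (x + - y)) = (norm x)\<^sup>2 - 2 * Re (cinner x y) + (norm y)\<^sup>2"
    using Re_cinner_commute[of x y] cinner_self[of x] cinner_self[of y]
    by (simp only: cinner_add_left cinner_add_right cinner_minus_left cinner_minus_right) simp
  then show ?thesis using zero_le_power2[of "norm (x - y)"] by (simp add: cinner_self)
qed

lemma cinner_scaleR_right: "cinner x (t *\<^sub>R y) = of_real t * cinner x (y :: 'h::complex_hilbert)"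
  by (metis cinner_commute cinner_scaleC_left complex_cnj_complex_of_real complex_cnj_mult scaleC_of_real)

lemma Re_cinner_sum_list: "Re (cinner (\<Sum>i\<leftarrow>xs. F i) \<eta>) = (\<Sum>i\<leftarrow>xs. Re (cinner (F i) (\<eta> :: 'h::complex_hilbert)))"
proof (induction xs)
  case Nil
  have "cinner 0 \<eta> = 0" using cinner_add_left[of 0 0 \<eta>] by simp
  then show ?case by simp
qed (simp add: cinner_add_left)

context etale_groupoid
begin

section \<open>Convolution on bisections\<close>

lemma convolve_unit_right:
  assumes a: "\<And>x. x \<notin> arrows G \<Longrightarrow> a x = 0" and b: "\<And>x. x \<notin> unit_space G \<Longrightarrow> b x = 0"
  shows "convolve G a b = (\<lambda>x. a x * b (src G x))"
proof
  fix c
  let ?S = "{(a, b) \<in> composable G. gmul G a b = c}"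
  show "convolve G a b c = a c * b (src G c)"
  proof (cases "c \<in> arrows G")
    case True
    have mem: "(c, src G c) \<in> ?S"
      using True src_in_units[OF True] src_in[OF True] by (auto simp: composable_def rng_unit mul_src)
    have "(\<Sum>\<^sub>\<infinity>(x, y)\<in>?S. a x * b y) = (\<Sum>\<^sub>\<infinity>(x, y)\<in>{(c, src G c)}. a x * b y)"
    proof (rule infsum_cong_neutral)
      fix q assume q: "q \<in> ?S - {(c, src G c)}"
      obtain x y where xy: "q = (x, y)" by fastforce
      have "y \<notin> unit_space G"
      proof
        assume "y \<in> unit_space G"
        then have "y = src G x" using q by (auto simp: xy composable_def rng_unit)
        then have "q = (c, src G c)" using q mul_src by (auto simp: xy composable_def)
        then show False using q by simp
      qed
      then show "(case q of (x, y) \<Rightarrow> a x * b y) = 0" using b by (simp add: xy)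
    qed (use mem in auto)
    then show ?thesis by (simp add: convolve_def)
  next
    case False
    then have "?S = {}" using mul_in by auto
    then show ?thesis using a[OF False] by (simp only: convolve_def infsum_empty mult_zero_left)
  qed
qed

text \<open>In a composable pair \<open>(x, y)\<close> with \<open>x\<close> and \<open>y\<inverse>\<close> in the bisection \<open>U\<close>, these two arrows share their
  source, hence coincide, and the product is the unit \<open>rng x\<close>.\<close>

lemma convolve_involute:
  assumes U: "bisection U" and a: "\<And>x. x \<notin> U \<Longrightarrow> a x = 0"
  shows "convolve G a (involute G a) = push (rng G) U (\<lambda>x. a x * cnj (a x))"
proof
  fix c
  have inj: "inj_on (src G) U" "inj_on (rng G) U" and UA: "U \<subseteq> arrows G"
    using U openin_subset by (auto simp: bisection_def)
  let ?S = "{(a, b) \<in> composable G. gmul G a b = c}"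
  let ?t = "\<lambda>(x, y). a x * involute G a y"
  have key: "x \<in> U \<and> y = ginv G x \<and> c = rng G x" if "(x, y) \<in> ?S" "?t (x, y) \<noteq> 0" for x y
  proof -
    have xy: "x \<in> arrows G" "y \<in> arrows G" "src G x = rng G y" "gmul G x y = c"
      using that by (auto simp: composable_def)
    have x: "x \<in> U" using that(2) a by auto
    have y: "ginv G y \<in> U" using that(2) a by (auto simp: involute_def split: if_splits)
    have "src G (ginv G y) = src G x" using xy src_inv by simp
    then have "x = ginv G y" using inj(1) x y by (auto simp: inj_on_def)
    then have "y = ginv G x" using inv_inv xy by simp
    then show ?thesis using x xy mul_inv by auto
  qed
  show "convolve G a (involute G a) c = push (rng G) U (\<lambda>x. a x * cnj (a x)) c"
  proof (cases "c \<in> rng G ` U")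
    case True
    then obtain x where x: "x \<in> U" "c = rng G x" by blast
    then have xa: "x \<in> arrows G" using UA by blast
    have mem: "(x, ginv G x) \<in> ?S"
      using x xa by (auto simp: composable_def inv_in rng_inv mul_inv)
    have "infsum ?t ?S = infsum ?t {(x, ginv G x)}"
    proof (rule infsum_cong_neutral)
      fix q assume q: "q \<in> ?S - {(x, ginv G x)}"
      obtain x' y' where q': "q = (x', y')" by fastforce
      show "?t q = 0"
      proof (rule ccontr)
        assume "?t q \<noteq> 0"
        then have "x' \<in> U \<and> y' = ginv G x' \<and> c = rng G x'" using key[of x' y'] q by (simp add: q')
        then show False using inj(2) x q by (auto simp: q' inj_on_def)
      qed
    qed (use mem in auto)
    also have "\<dots> = a x * cnj (a x)" using xa by (simp add: involute_def inv_in inv_inv)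
    finally show ?thesis using push_eq[OF inj(2) x(1), where u = "\<lambda>x. a x * cnj (a x)"] x(2)
      by (simp add: convolve_def)
  next
    case False
    have "infsum ?t ?S = infsum (\<lambda>_. 0) ?S"
      by (rule infsum_cong) (use key False in force)
    then show ?thesis using False by (simp add: convolve_def push_outside)
  qed
qed

lemma involute_unit_supported:
  assumes "\<And>x. x \<notin> unit_space G \<Longrightarrow> b x = 0"
  shows "involute G b = (\<lambda>x. cnj (b x))"
proof
  fix c
  show "involute G b c = cnj (b c)"
  proof (cases "c \<in> unit_space G")
    case True then show ?thesis using inv_unit units_subset by (auto simp: involute_def)
  next
    case False
    have "ginv G c \<notin> unit_space G" if c: "c \<in> arrows G"
    proof
      assume "ginv G c \<in> unit_space G"
      then have "ginv G c = c" using inv_unit[of "ginv G c"] inv_inv[OF c] by simp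
      then show False using False \<open>ginv G c \<in> unit_space G\<close> by simp
    qed
    then show ?thesis using False assms by (auto simp: involute_def)
  qed
qed

end

lemma (in lc_etale_groupoid) involute_compactly_supported:
  assumes U: "U \<subseteq> arrows G" and f: "compactly_supported (gtop G) U f"
  shows "compactly_supported (gtop G) (ginv G ` U) (involute G f)"
proof -
  obtain K where K: "compactin (gtop G) K" "K \<subseteq> U" "\<And>x. x \<notin> K \<Longrightarrow> f x = 0"
    and cont: "continuous_map (subtopology (gtop G) U) euclidean f"
    using f by (auto simp: compactly_supported_def)
  have "continuous_map (subtopology (gtop G) (ginv G ` U)) (subtopology (gtop G) U) (ginv G)"
    unfolding continuous_map_in_subtopology
    using continuous_inv inv_inv U by (auto simp: continuous_map_from_subtopology Pi_iff subset_eq)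
  then have "continuous_map (subtopology (gtop G) (ginv G ` U)) euclidean (cnj \<circ> (f \<circ> ginv G))"
    using cont by (intro continuous_map_compose[where X' = euclidean] continuous_map_compose[where X' = "subtopology (gtop G) U"])
      (auto intro!: continuous_intros)
  then have "continuous_map (subtopology (gtop G) (ginv G ` U)) euclidean (involute G f)"
    by (rule continuous_map_eq) (auto simp: involute_def)
  moreover have "compactin (gtop G) (ginv G ` K)" using K(1) continuous_inv image_compactin by blast
  moreover have "involute G f x = 0" if "x \<notin> ginv G ` K" for x
    using that K(3) inv_inv by (auto simp: involute_def image_iff) metis
  ultimately show ?thesis using K(2) unfolding compactly_supported_def by blast
qed

lemma continuous_phase_sqrt: "continuous_on UNIV (\<lambda>z::complex. z / of_real (sqrt (cmod z)))"
proof -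
  have "isCont (\<lambda>z::complex. z / of_real (sqrt (cmod z))) z" for z
  proof (cases "z = 0")
    case True
    have "((\<lambda>z. sqrt (cmod z)) \<longlongrightarrow> 0) (at (0::complex))"
      by (rule tendsto_eq_intros refl tendsto_ident_at | simp)+
    moreover have "norm (z / of_real (sqrt (cmod z))) = sqrt (cmod z)" for z :: complex
      by (simp add: norm_divide real_div_sqrt)
    ultimately have "((\<lambda>z. z / of_real (sqrt (cmod z))) \<longlongrightarrow> 0) (at (0::complex))"
      by (subst tendsto_norm_zero_iff[symmetric]) simp
    then show ?thesis using True by (simp add: isCont_def)
  qed (auto intro!: continuous_intros)
  then show ?thesis by (simp add: continuous_at_imp_continuous_on)
qed

section \<open>Estimates for representations\<close>

locale groupoid_representation = lc_etale_groupoid G for G :: "'g groupoid_data" +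
  fixes \<pi> :: "('g \<Rightarrow> complex) \<Rightarrow> ('h::complex_hilbert \<Rightarrow>\<^sub>L 'h)"
  assumes star_hom: "star_homomorphism G \<pi>"
begin

lemma rep_add: "f \<in> conv_algebra G \<Longrightarrow> g \<in> conv_algebra G \<Longrightarrow> \<pi> (\<lambda>x. f x + g x) = \<pi> f + \<pi> g"
  using star_hom unfolding star_homomorphism_def plus_fun_def by blast

lemma rep_scale: "f \<in> conv_algebra G \<Longrightarrow> blinfun_apply (\<pi> (\<lambda>x. c * f x)) \<xi> = c *\<^sub>C blinfun_apply (\<pi> f) \<xi>"
  using star_hom unfolding star_homomorphism_def scale_fun_def by blast

lemma rep_convolve: "f \<in> conv_algebra G \<Longrightarrow> g \<in> conv_algebra G \<Longrightarrow>
    blinfun_apply (\<pi> (convolve G f g)) \<xi> = blinfun_apply (\<pi> f) (blinfun_apply (\<pi> g) \<xi>)"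
  using star_hom unfolding star_homomorphism_def by simp

lemma rep_adjoint: "f \<in> conv_algebra G \<Longrightarrow>
    cinner (blinfun_apply (\<pi> f) \<xi>) \<eta> = cinner \<xi> (blinfun_apply (\<pi> (involute G f)) \<eta>)"
  using star_hom unfolding star_homomorphism_def is_adjoint_def by blast

definition vector_functional :: "'h \<Rightarrow> ('g \<Rightarrow> real) \<Rightarrow> real"
  where "vector_functional \<xi> u = Re (cinner (blinfun_apply (\<pi> (\<lambda>x. complex_of_real (u x))) \<xi>) \<xi>)"

lemma conv_algebra_units:
  "compactly_supported (gtop G) (unit_space G) u \<Longrightarrow> (\<lambda>x. complex_of_real (u x)) \<in> conv_algebra G"
  using conv_algebra_bisection[OF bisection_units] compactly_supported_of_real by blast

lemma convolve_units:
  assumes "compactly_supported (gtop G) (unit_space G) u" "compactly_supported (gtop G) (unit_space G) v"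
  shows "convolve G (\<lambda>x. complex_of_real (u x)) (\<lambda>x. complex_of_real (v x)) = (\<lambda>x. complex_of_real (u x * v x))"
proof -
  have out: "x \<notin> unit_space G \<Longrightarrow> u x = 0" "x \<notin> unit_space G \<Longrightarrow> v x = 0" for x
    using assms[THEN compactly_supported_outside] by auto
  have "u x * v (src G x) = u x * v x" for x
    using out[of x] src_unit by (cases "x \<in> unit_space G") auto
  then show ?thesis
    using out units_subset by (subst convolve_unit_right) (auto simp flip: of_real_mult)
qed

lemma cinner_units_symmetric:
  assumes u: "compactly_supported (gtop G) (unit_space G) u"
  shows "cinner (blinfun_apply (\<pi> (\<lambda>x. complex_of_real (u x))) \<xi>) \<eta> =
    cinner \<xi> (blinfun_apply (\<pi> (\<lambda>x. complex_of_real (u x))) \<eta>)"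
proof -
  have "involute G (\<lambda>x. complex_of_real (u x)) = (\<lambda>x. complex_of_real (u x))"
    using compactly_supported_outside[OF u] by (subst involute_unit_supported) auto
  then show ?thesis using rep_adjoint[OF conv_algebra_units[OF u]] by simp
qed

lemma vector_functional_square:
  assumes u: "compactly_supported (gtop G) (unit_space G) u"
  shows "vector_functional \<xi> (\<lambda>x. (u x)\<^sup>2) = (norm (blinfun_apply (\<pi> (\<lambda>x. complex_of_real (u x))) \<xi>))\<^sup>2"
proof -
  let ?u = "\<lambda>x. complex_of_real (u x)"
  have "complex_of_real ((norm (blinfun_apply (\<pi> ?u) \<xi>))\<^sup>2) = cinner (blinfun_apply (\<pi> ?u) (blinfun_apply (\<pi> ?u) \<xi>)) \<xi>"
    by (simp only: cinner_self[symmetric] cinner_units_symmetric[OF u])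
  also have "\<dots> = cinner (blinfun_apply (\<pi> (\<lambda>x. complex_of_real ((u x)\<^sup>2))) \<xi>) \<xi>"
    by (simp only: rep_convolve[OF conv_algebra_units[OF u] conv_algebra_units[OF u], symmetric]
        convolve_units[OF u u] power2_eq_square)
  finally show ?thesis unfolding vector_functional_def by (metis Re_complex_of_real)
qed

text \<open>Positivity holds because nonnegative functions on the unit space have square roots. The bound on the
  total mass is automatic: for a bump \<open>u\<close> the function \<open>u - u\<^sup>2\<close> is again a square, so that
  \<open>\<parallel>\<pi>(u)\<xi>\<parallel>\<^sup>2 \<le> \<langle>\<pi>(u)\<xi>, \<xi>\<rangle>\<close>, and this forces \<open>\<langle>\<pi>(u)\<xi>, \<xi>\<rangle> \<le> \<parallel>\<xi>\<parallel>\<^sup>2\<close>.\<close>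

lemma positive_functional_vector:
  "positive_functional (gtop G) (unit_space G) (vector_functional \<xi>) ((norm \<xi>)\<^sup>2)"
proof
  show "openin (gtop G) (unit_space G)" "Hausdorff_space (subtopology (gtop G) (unit_space G))"
    "locally_compact (gtop G)"
    using openin_units Hausdorff_open_units loc_compact by auto
next
  fix u v :: "'g \<Rightarrow> real"
  assume "compactly_supported (gtop G) (unit_space G) u" "compactly_supported (gtop G) (unit_space G) v"
  then show "vector_functional \<xi> (\<lambda>x. u x + v x) = vector_functional \<xi> u + vector_functional \<xi> v"
    using rep_add[OF conv_algebra_units conv_algebra_units]
    by (simp add: vector_functional_def blinfun.add_left cinner_add_left)
next
  fix u :: "'g \<Rightarrow> real" and a :: real
  assume "compactly_supported (gtop G) (unit_space G) u"
  then show "vector_functional \<xi> (\<lambda>x. a * u x) = a * vector_functional \<xi> u"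
    using rep_scale[OF conv_algebra_units, of u "of_real a" \<xi>]
    by (simp add: vector_functional_def cinner_scaleC_left)
next
  show nonneg: "0 \<le> vector_functional \<xi> u"
    if u: "compactly_supported (gtop G) (unit_space G) u" "\<And>x. 0 \<le> u x" for u :: "'g \<Rightarrow> real"
  proof -
    have "compactly_supported (gtop G) (unit_space G) (\<lambda>x. sqrt (u x))"
      by (rule compactly_supported_comp[OF u(1)]) (auto intro!: continuous_intros)
    from vector_functional_square[OF this] show ?thesis using u(2) by simp
  qed
  fix u assume u: "u \<in> bumps (gtop G) (unit_space G)"
  then have cs: "compactly_supported (gtop G) (unit_space G) u" and u01: "0 \<le> u x" "u x \<le> 1" for x
    by (auto simp: bumps_def)
  let ?T = "blinfun_apply (\<pi> (\<lambda>x. complex_of_real (u x)))"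
  have cs2: "compactly_supported (gtop G) (unit_space G) (\<lambda>x. sqrt (u x * (1 - u x)))"
    by (rule compactly_supported_comp[OF cs, where \<phi> = "\<lambda>t. sqrt (t * (1 - t))"]) (auto intro!: continuous_intros)
  have cs3: "compactly_supported (gtop G) (unit_space G) (\<lambda>x. (u x)\<^sup>2)"
    by (rule compactly_supported_comp[OF cs]) (auto intro!: continuous_intros)
  have cs4: "compactly_supported (gtop G) (unit_space G) (\<lambda>x. (sqrt (u x * (1 - u x)))\<^sup>2)"
    by (rule compactly_supported_comp[OF cs2]) (auto intro!: continuous_intros)
  have "vector_functional \<xi> u = vector_functional \<xi> (\<lambda>x. (u x)\<^sup>2 + (sqrt (u x * (1 - u x)))\<^sup>2)"
  proof -
    have "(sqrt (u x * (1 - u x)))\<^sup>2 = u x * (1 - u x)" for x using u01[of x] by simp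
    then show ?thesis by (simp only:) (simp add: algebra_simps power2_eq_square)
  qed
  also have "\<dots> = (norm (?T \<xi>))\<^sup>2 + (norm (blinfun_apply (\<pi> (\<lambda>x. complex_of_real (sqrt (u x * (1 - u x))))) \<xi>))\<^sup>2"
    using rep_add[OF conv_algebra_units[OF cs3] conv_algebra_units[OF cs4]]
      vector_functional_square[OF cs, of \<xi>] vector_functional_square[OF cs2, of \<xi>]
    by (simp add: vector_functional_def blinfun.add_left cinner_add_left)
  finally have "(norm (?T \<xi>))\<^sup>2 \<le> vector_functional \<xi> u" by simp
  moreover have "2 * vector_functional \<xi> u \<le> (norm (?T \<xi>))\<^sup>2 + (norm \<xi>)\<^sup>2"
    unfolding vector_functional_def by (rule Re_cinner_le)
  ultimately show "vector_functional \<xi> u \<le> (norm \<xi>)\<^sup>2" by simp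
qed

text \<open>The factorization \<open>h = a * b\<close>, where \<open>b = |h|\<^sup>1\<^sup>/\<^sup>2\<close> is transported to the unit space by the source map
  and \<open>a = h / |h|\<^sup>1\<^sup>/\<^sup>2\<close>, splits the matrix coefficient as \<open>\<langle>\<pi>(b)\<xi>, \<pi>(a\<^sup>*)\<eta>\<rangle>\<close>. The squared norms of the two
  vectors involve \<open>b * b\<close> and \<open>a * a\<^sup>*\<close>, which are the push-forwards of \<open>|h|\<close> along source and range.\<close>

lemma bisection_estimate:
  assumes U: "bisection U" and h: "compactly_supported (gtop G) U h"
  shows "2 * Re (cinner (blinfun_apply (\<pi> h) \<xi>) \<eta>) \<le>
    vector_functional \<xi> (push (src G) U (\<lambda>a. cmod (h a))) + vector_functional \<eta> (push (rng G) U (\<lambda>a. cmod (h a)))"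
proof -
  have s: "src G = src G \<or> src G = rng G" by simp
  have inj: "inj_on (src G) U" using U by (simp add: bisection_def)
  have UA: "U \<subseteq> arrows G" using U openin_subset by (auto simp: bisection_def)
  define a where "a x = h x / of_real (sqrt (cmod (h x)))" for x
  define b where "b = push (src G) U (\<lambda>x. sqrt (cmod (h x)))"
  have cs_a: "compactly_supported (gtop G) U a"
    unfolding a_def by (rule compactly_supported_comp[OF h continuous_phase_sqrt]) simp
  have cs_b: "compactly_supported (gtop G) (unit_space G) b"
    unfolding b_def
    by (rule push_compactly_supported_units[OF s U compactly_supported_comp[OF h]])
      (auto intro!: continuous_intros)
  note A = conv_algebra_bisection[OF U cs_a] and B = conv_algebra_units[OF cs_b]
  have A': "involute G a \<in> conv_algebra G"
    by (rule conv_algebra_bisection[OF bisection_inv[OF U] involute_compactly_supported[OF UA cs_a]])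
  have a_out: "x \<notin> U \<Longrightarrow> a x = 0" for x using compactly_supported_outside[OF cs_a] by blast
  have "h = convolve G a (\<lambda>x. complex_of_real (b x))"
  proof -
    have "a x * complex_of_real (b (src G x)) = h x" for x
    proof (cases "x \<in> U")
      case True
      then show ?thesis by (simp add: a_def b_def push_eq[OF inj])
    next
      case False
      then show ?thesis using a_out compactly_supported_outside[OF h False] by simp
    qed
    then show ?thesis
      using a_out UA compactly_supported_outside[OF cs_b] by (subst convolve_unit_right) auto
  qed
  then have "cinner (blinfun_apply (\<pi> h) \<xi>) \<eta> =
      cinner (blinfun_apply (\<pi> (\<lambda>x. complex_of_real (b x))) \<xi>) (blinfun_apply (\<pi> (involute G a)) \<eta>)"
    using rep_convolve[OF A B] rep_adjoint[OF A] by simp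
  then have "2 * Re (cinner (blinfun_apply (\<pi> h) \<xi>) \<eta>) \<le>
      (norm (blinfun_apply (\<pi> (\<lambda>x. complex_of_real (b x))) \<xi>))\<^sup>2 + (norm (blinfun_apply (\<pi> (involute G a)) \<eta>))\<^sup>2"
    using Re_cinner_le by simp
  also have "(norm (blinfun_apply (\<pi> (\<lambda>x. complex_of_real (b x))) \<xi>))\<^sup>2 =
      vector_functional \<xi> (push (src G) U (\<lambda>a. cmod (h a)))"
  proof -
    have "(\<lambda>x. (b x)\<^sup>2) = push (src G) U (\<lambda>a. cmod (h a))" by (auto simp: b_def push_def fun_eq_iff)
    then show ?thesis using vector_functional_square[OF cs_b, of \<xi>] by simp
  qed
  also have "(norm (blinfun_apply (\<pi> (involute G a)) \<eta>))\<^sup>2 = vector_functional \<eta> (push (rng G) U (\<lambda>a. cmod (h a)))"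
  proof -
    have "a x * cnj (a x) = complex_of_real (cmod (h x))" for x
    proof -
      have "a x * cnj (a x) = complex_of_real ((cmod (a x))\<^sup>2)" by (simp only: complex_norm_square)
      also have "(cmod (a x))\<^sup>2 = cmod (h x)"
        by (simp add: a_def norm_divide power_divide power2_eq_square)
      finally show ?thesis .
    qed
    then have "convolve G a (involute G a) = (\<lambda>x. complex_of_real (push (rng G) U (\<lambda>a. cmod (h a)) x))"
      using convolve_involute[OF U a_out] by (auto simp: push_def fun_eq_iff)
    then have "vector_functional \<eta> (push (rng G) U (\<lambda>a. cmod (h a))) =
        Re (cinner (blinfun_apply (\<pi> (involute G a)) \<eta>) (blinfun_apply (\<pi> (involute G a)) \<eta>))"
      using rep_convolve[OF A A'] rep_adjoint[OF A] unfolding vector_functional_def by metis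
    then show ?thesis by (simp add: cinner_self)
  qed
  finally show ?thesis .
qed

lemma rep_sum_list:
  assumes "\<And>U h. (U, h) \<in> set hs \<Longrightarrow> bisection U \<and> compactly_supported (gtop G) U h"
  shows "(\<lambda>a. \<Sum>(U, h)\<leftarrow>hs. h a) \<in> conv_algebra G \<and>
    blinfun_apply (\<pi> (\<lambda>a. \<Sum>(U, h)\<leftarrow>hs. h a)) \<xi> = (\<Sum>(U, h)\<leftarrow>hs. blinfun_apply (\<pi> h) \<xi>)"
  using assms
proof (induction hs)
  case Nil
  have "0 *\<^sub>C y = 0" for y :: 'h using scaleC_of_real[of 0 y] by simp
  then have "blinfun_apply (\<pi> (\<lambda>x. 0)) \<xi> = 0"
    using rep_scale[OF conv_algebra_0, of 0 \<xi>] by simp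
  then show ?case by (simp add: conv_algebra_0)
next
  case (Cons p hs)
  obtain U h where p: "p = (U, h)" by fastforce
  have "h \<in> conv_algebra G" using Cons.prems[of U h] conv_algebra_bisection[of U h] by (simp add: p)
  moreover have "(\<lambda>a. \<Sum>(U, h)\<leftarrow>hs. h a) \<in> conv_algebra G \<and>
    blinfun_apply (\<pi> (\<lambda>a. \<Sum>(U, h)\<leftarrow>hs. h a)) \<xi> = (\<Sum>(U, h)\<leftarrow>hs. blinfun_apply (\<pi> h) \<xi>)"
    by (rule Cons.IH) (use Cons.prems in auto)
  ultimately show ?case
    by (simp add: p conv_algebra_add rep_add blinfun.add_left)
qed

lemma matrix_coefficient_bound:
  assumes f: "f \<in> conv_algebra G" and c: "I_norm G f \<le> ennreal c" "0 \<le> c"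
  shows "2 * Re (cinner (blinfun_apply (\<pi> f) \<xi>) \<eta>) \<le> c * ((norm \<xi>)\<^sup>2 + (norm \<eta>)\<^sup>2)"
proof (rule field_le_epsilon)
  fix e :: real assume e: "0 < e"
  obtain ps where ps: "\<And>U h. (U, h) \<in> set ps \<Longrightarrow> bisection U \<and> compactly_supported (gtop G) U h"
    and f_ps: "\<And>a. f a = (\<Sum>(U, h)\<leftarrow>ps. h a)"
    using conv_algebra_decomposition[OF f] by blast
  have "\<exists>B\<ge>0. \<forall>(U, h)\<in>set ps. \<forall>a. cmod (h a) \<le> B"
    using ps
  proof (induction ps)
    case (Cons p ps)
    then obtain B where B: "0 \<le> B" "\<forall>(U, h)\<in>set ps. \<forall>a. cmod (h a) \<le> B" by auto
    obtain U h where p: "p = (U, h)" by fastforce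
    then obtain B' where "\<forall>a. cmod (h a) \<le> B'"
      using compactly_supported_bounded[of "gtop G" U h] Cons.prems[of U h] by auto
    then show ?case using B by (intro exI[of _ "max B B'"]) (fastforce simp: p le_max_iff_disj)
  qed auto
  then obtain B where B: "0 \<le> B" "\<And>U h a. (U, h) \<in> set ps \<Longrightarrow> cmod (h a) \<le> B" by blast
  define n where "n = real (length ps * length ps)"
  \<comment> \<open>The total error is \<open>4 B n \<epsilon>\<close>; the summand 1 avoids division by zero.\<close>
  define \<epsilon> where "\<epsilon> = e / (4 * B * n + 1)"
  have n: "0 \<le> n" by (simp add: n_def)
  have pos: "0 < 4 * B * n + 1" using B(1) n by (simp add: add_nonneg_pos)
  have \<epsilon>: "0 < \<epsilon>" "4 * B * n * \<epsilon> \<le> e"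
    using e pos B(1) n by (auto simp: \<epsilon>_def field_simps)
  note L\<xi> = positive_functional_vector[of \<xi>] and L\<eta> = positive_functional_vector[of \<eta>]
  let ?good = "\<lambda>W \<psi>.
    positive_functional.mass (gtop G) (vector_functional \<xi>) (src G ` W) - \<epsilon> \<le> vector_functional \<xi> (push (src G) W \<psi>) \<and>
    positive_functional.mass (gtop G) (vector_functional \<eta>) (rng G ` W) - \<epsilon> \<le> vector_functional \<eta> (push (rng G) W \<psi>)"
  have good: "\<exists>\<psi>\<in>bumps (gtop G) W. ?good W \<psi>" if "bisection W" for W
    using near_maximal_bump[OF L\<xi> L\<eta> that \<epsilon>(1)] by blast
  obtain hs ws where
    hs: "\<And>U h. (U, h) \<in> set hs \<Longrightarrow> bisection U \<and> compactly_supported (gtop G) U h"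
    and ws: "\<And>W \<psi>. (W, \<psi>) \<in> set ws \<Longrightarrow> bisection W \<and> \<psi> \<in> bumps (gtop G) W \<and> ?good W \<psi>"
    and len: "length ws \<le> length ps * length ps"
    and f_hs: "\<And>a. (\<Sum>(U, h)\<leftarrow>hs. h a) = (\<Sum>(U, f)\<leftarrow>ps. f a)"
    and le: "\<And>a. (\<Sum>(U, h)\<leftarrow>hs. cmod (h a)) \<le>
      cmod (\<Sum>(U, f)\<leftarrow>ps. f a) + 2 * B * (\<Sum>(W, \<psi>)\<leftarrow>ws. indicator W a - \<psi> a)"
    by (rule almost_disjoint_pieces[of ?good ps B]) (use good ps B(2) in blast)+
  have le': "(\<Sum>(U, h)\<leftarrow>hs. cmod (h a)) \<le> cmod (f a) + 2 * B * (\<Sum>(W, \<psi>)\<leftarrow>ws. indicator W a - \<psi> a)" for a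
    using le[of a] f_ps[of a] by simp
  have B2: "0 \<le> 2 * B" using B(1) by simp
  have S: "(\<Sum>(U, h)\<leftarrow>hs. vector_functional \<xi> (push (src G) U (\<lambda>a. cmod (h a)))) \<le>
      c * (norm \<xi>)\<^sup>2 + 2 * B * (length ws * \<epsilon>)"
    by (rule positive_functional_estimate[OF L\<xi> _ c B2 hs _ le']) (use ws in auto)
  have R: "(\<Sum>(U, h)\<leftarrow>hs. vector_functional \<eta> (push (rng G) U (\<lambda>a. cmod (h a)))) \<le>
      c * (norm \<eta>)\<^sup>2 + 2 * B * (length ws * \<epsilon>)"
    by (rule positive_functional_estimate[OF L\<eta> _ c B2 hs _ le']) (use ws in auto)
  have "f = (\<lambda>a. \<Sum>(U, h)\<leftarrow>hs. h a)" using f_ps f_hs by auto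
  then have "2 * Re (cinner (blinfun_apply (\<pi> f) \<xi>) \<eta>) = 2 * (\<Sum>(U, h)\<leftarrow>hs. Re (cinner (blinfun_apply (\<pi> h) \<xi>) \<eta>))"
    using rep_sum_list[OF hs, of hs \<xi>] by (simp add: Re_cinner_sum_list case_prod_unfold)
  also have "\<dots> = (\<Sum>(U, h)\<leftarrow>hs. 2 * Re (cinner (blinfun_apply (\<pi> h) \<xi>) \<eta>))"
    by (induction hs) auto
  also have "\<dots> \<le> (\<Sum>(U, h)\<leftarrow>hs. vector_functional \<xi> (push (src G) U (\<lambda>a. cmod (h a))) +
      vector_functional \<eta> (push (rng G) U (\<lambda>a. cmod (h a))))"
    using hs bisection_estimate by (intro sum_list_mono) (auto split: prod.splits)
  also have "\<dots> = (\<Sum>(U, h)\<leftarrow>hs. vector_functional \<xi> (push (src G) U (\<lambda>a. cmod (h a)))) +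
      (\<Sum>(U, h)\<leftarrow>hs. vector_functional \<eta> (push (rng G) U (\<lambda>a. cmod (h a))))"
    by (induction hs) auto
  also have "\<dots> \<le> c * ((norm \<xi>)\<^sup>2 + (norm \<eta>)\<^sup>2) + 4 * B * length ws * \<epsilon>"
    using S R by (simp add: algebra_simps)
  also have "4 * B * length ws * \<epsilon> \<le> 4 * B * n * \<epsilon>"
    using B(1) \<epsilon>(1) len unfolding n_def by (intro mult_right_mono mult_left_mono of_nat_mono) auto
  also have "\<dots> \<le> e" by (rule \<epsilon>(2))
  finally show "2 * Re (cinner (blinfun_apply (\<pi> f) \<xi>) \<eta>) \<le> c * ((norm \<xi>)\<^sup>2 + (norm \<eta>)\<^sup>2) + e" by simp
qed

lemma norm_rep_le:
  assumes f: "f \<in> conv_algebra G" and c: "I_norm G f \<le> ennreal c" "0 \<le> c"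
  shows "norm (\<pi> f) \<le> c"
proof (rule norm_blinfun_bound[OF c(2)])
  fix \<xi>
  let ?y = "blinfun_apply (\<pi> f) \<xi>"
  show "norm ?y \<le> c * norm \<xi>"
  proof (cases "?y = 0 \<or> \<xi> = 0")
    case False
    then have ny: "0 < norm ?y" "0 < norm \<xi>" by auto
    \<comment> \<open>The multiple of \<open>?y\<close> that has the norm of \<open>\<xi>\<close> makes the arithmetic mean estimate sharp.\<close>
    define t where "t = norm \<xi> / norm ?y"
    have "Re (cinner ?y (t *\<^sub>R ?y)) = t * (norm ?y)\<^sup>2" by (simp add: cinner_scaleR_right cinner_self)
    then have "2 * (t * (norm ?y)\<^sup>2) \<le> c * ((norm \<xi>)\<^sup>2 + (norm (t *\<^sub>R ?y))\<^sup>2)"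
      using matrix_coefficient_bound[OF f c, of \<xi> "t *\<^sub>R ?y"] by simp
    also have "norm (t *\<^sub>R ?y) = norm \<xi>" using ny by (simp add: t_def)
    also have "t * (norm ?y)\<^sup>2 = norm \<xi> * norm ?y" using ny by (simp add: t_def power2_eq_square)
    finally have "norm \<xi> * norm ?y \<le> norm \<xi> * (c * norm \<xi>)" by (simp add: power2_eq_square algebra_simps)
    then show ?thesis using ny by simp
  qed (use c(2) in auto)
qed

end

theorem corollary6p6:
  fixes G :: "'g groupoid_data"
    and \<pi> :: "('g \<Rightarrow> complex) \<Rightarrow> ('h::complex_hilbert \<Rightarrow>\<^sub>L 'h)"
  assumes "etale_groupoid G"
    and "second_countable (gtop G)"
    and "locally_compact (gtop G)"
    and "Hausdorff_space (unit_topology G)"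
    and "star_homomorphism G \<pi>"
  shows "\<exists>M::real. 0 \<le> M \<and>
    (\<forall>f \<in> conv_algebra G. ennreal (norm (\<pi> f)) \<le> ennreal M * I_norm G f)"
proof -
  interpret groupoid_representation G \<pi>
    using assms by (simp add: groupoid_representation_def lc_etale_groupoid_def
        lc_etale_groupoid_axioms_def groupoid_representation_axioms_def)
  have "ennreal (norm (\<pi> f)) \<le> I_norm G f" if f: "f \<in> conv_algebra G" for f
  proof (cases "I_norm G f")
    case (real c)
    then show ?thesis using norm_rep_le[OF f, of c] by (simp add: ennreal_leI)
  next
    case top
    then show ?thesis by simp
  qed
  then show ?thesis by (intro exI[of _ 1]) simp
qed

end
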